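(* Disjoint Factors parameterized by $|\Sigma|$ admits a PSAKS.
   Context: For a string $L$ over alphabet $\Sigma$, a factor is a position substring of length at least $2$ starting and ending with the same letter; a set of disjoint factors is a set of factors that pairwise do not overlap (not even at endpoints) and pairwise start at different letters. Disjoint Factors is the parameterized maximization problem $DF(L,|\Sigma|,{\cal S})=-\infty$ if ${\cal S}$ is not a set of disjoint factors of $L$, and $|{\cal S}|$ otherwise. A PSAKS (polynomial size approximate kernelization scheme) is a family, one for every $\alpha>1$, of $\alpha$-approximate kernels of size polynomial in the parameter: a polynomial-time reduction algorithm mapping $(I,k)$ to $(I',k')$ with $|I'|+k'$ bounded by a polynomial in $k$, together with a polynomial-time solution lifting algorithm turning a solution $s'$ of $(I',k')$ into a solution $s$ of $(I,k)$ with $\alpha\cdot\frac{\Pi(I,k,s)}{OPT(I,k)}\ge\frac{\Pi(I',k',s')}{OPT(I',k')}$ (for maximization problems). *)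

theory Defs
  imports "HOL-Library.Extended_Real" "HOL-Computational_Algebra.Polynomial"
begin

section \<open>Polynomial time\<close>

text \<open>
  The model of computation is a variable-free form of Jones' WHILE language (N. D. Jones,
  Computability and Complexity from a Programming Perspective): programs transform binary trees,
  by building and destructing trees, by composition, branching and unbounded loops. A store of
  several variables is a nested pair. \<open>Leaf\<close> plays the role of both nil and false.
\<close>

datatype tree = Leaf | Node tree tree

fun tsize :: "tree \<Rightarrow> nat" where
  "tsize Leaf = 1"
| "tsize (Node x y) = Suc (tsize x + tsize y)"

datatype prog =
    Skip
  | ToLeaf
  | Head
  | Tail
  | Join prog prog
  | Then prog prog
  | Cond prog prog prog
  | Loop prog prog

text \<open>
  \<open>exec p x y t\<close>: program \<open>p\<close> on input \<open>x\<close> halts with output \<open>y\<close> after time \<open>t\<close>.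
  A program that does not halt on \<open>x\<close> has no \<open>y\<close> and \<open>t\<close>.
  Every elementary action is charged the size of the tree it acts on, not unit cost. Hence
  trees cannot be doubled for free (see \<open>exec_tsize\<close> below), and time agrees with time on
  Turing machines up to a polynomial.
\<close>

inductive exec :: "prog \<Rightarrow> tree \<Rightarrow> tree \<Rightarrow> nat \<Rightarrow> bool" where
  Skip: "exec Skip x x (tsize x)"
| ToLeaf: "exec ToLeaf x Leaf (tsize x)"
| Head_Leaf: "exec Head Leaf Leaf (tsize Leaf)"
| Head_Node: "exec Head (Node y z) y (tsize (Node y z))"
| Tail_Leaf: "exec Tail Leaf Leaf (tsize Leaf)"
| Tail_Node: "exec Tail (Node y z) z (tsize (Node y z))"
| Join: "exec p x y t \<Longrightarrow> exec q x z u \<Longrightarrow> exec (Join p q) x (Node y z) (tsize x + t + u)"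
| Then: "exec p x y t \<Longrightarrow> exec q y z u \<Longrightarrow> exec (Then p q) x z (tsize x + t + u)"
| Cond_True: "exec b x (Node v w) t \<Longrightarrow> exec p x y u \<Longrightarrow> exec (Cond b p q) x y (tsize x + t + u)"
| Cond_False: "exec b x Leaf t \<Longrightarrow> exec q x y u \<Longrightarrow> exec (Cond b p q) x y (tsize x + t + u)"
| Loop_True: "exec b x (Node v w) t \<Longrightarrow> exec p x y u \<Longrightarrow> exec (Loop b p) y z r \<Longrightarrow>
    exec (Loop b p) x z (tsize x + t + u + r)"
| Loop_False: "exec b x Leaf t \<Longrightarrow> exec (Loop b p) x x (tsize x + t)"

lemma exec_tsize: "exec p x y t \<Longrightarrow> tsize x \<le> t \<and> tsize y \<le> t"
proof (induction rule: exec.induct)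
  case (Join p x y t q z u)
  have "1 \<le> tsize x" by (cases x) auto
  with Join show ?case by simp
next
  case (ToLeaf x)
  have "1 \<le> tsize x" by (cases x) auto
  then show ?case by simp
qed auto

lemma exec_deterministic: "exec p x y t \<Longrightarrow> exec p x y' t' \<Longrightarrow> y' = y \<and> t' = t"
proof (induction arbitrary: y' t' rule: exec.induct)
  case (Join p x y t q z u)
  from Join.prems show ?case by cases (use Join.IH in blast)
next
  case (Then p x y t q z u)
  from Then.prems show ?case by cases (use Then.IH in blast)
next
  case (Cond_True b x v w t p y u q)
  from Cond_True.prems show ?case by cases (use Cond_True.IH in blast)+
next
  case (Cond_False b x t q y u p)
  from Cond_False.prems show ?case by cases (use Cond_False.IH in blast)+
next
  case (Loop_True b x v w t p y u z r)
  from Loop_True.prems show ?case by cases (use Loop_True.IH in blast)+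
next
  case (Loop_False b x t p)
  from Loop_False.prems show ?case by cases (use Loop_False.IH in blast)+
qed (auto elim: exec.cases)

text \<open>
  Naturals are encoded in unary. This is harmless here: it is only used for the parameter, for
  letters, which are smaller than the parameter, and for positions in the string.
\<close>

fun enc_nat :: "nat \<Rightarrow> tree" where
  "enc_nat 0 = Leaf"
| "enc_nat (Suc n) = Node Leaf (enc_nat n)"

fun enc_list :: "('a \<Rightarrow> tree) \<Rightarrow> 'a list \<Rightarrow> tree" where
  "enc_list e [] = Leaf"
| "enc_list e (x # xs) = Node (e x) (enc_list e xs)"

fun enc_pair :: "('a \<Rightarrow> tree) \<Rightarrow> ('b \<Rightarrow> tree) \<Rightarrow> 'a \<times> 'b \<Rightarrow> tree" where
  "enc_pair e e' (x, y) = Node (e x) (e' y)"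

definition poly_time_on ::
  "'a set \<Rightarrow> ('a \<Rightarrow> tree) \<Rightarrow> ('b \<Rightarrow> tree) \<Rightarrow> ('a \<Rightarrow> 'b) \<Rightarrow> bool" where
  "poly_time_on A e e' f \<longleftrightarrow>
     (\<exists>(p :: prog) (c :: nat poly). \<forall>x\<in>A. \<exists>t.
        exec p (e x) (e' (f x)) t \<and> t \<le> poly c (tsize (e x)))"

section \<open>Parameterized maximization problems and approximate kernels\<close>

text \<open>
  \<open>valu\<close> \<open>I k s\<close> is the value \<open>\<Pi>(I, k, s)\<close>, which is \<open>- \<infinity>\<close> if \<open>s\<close> is not a feasible solution.
\<close>

record ('i, 's) param_max_problem =
  insts :: "('i \<times> nat) set"
  valu :: "'i \<Rightarrow> nat \<Rightarrow> 's \<Rightarrow> ereal"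
  enc_inst :: "'i \<Rightarrow> tree"
  enc_sol :: "'s \<Rightarrow> tree"

definition inst_size :: "('i, 's) param_max_problem \<Rightarrow> 'i \<Rightarrow> nat" where
  "inst_size \<Pi> I = tsize (enc_inst \<Pi> I)"

definition OPT :: "('i, 's) param_max_problem \<Rightarrow> 'i \<Rightarrow> nat \<Rightarrow> ereal" where
  "OPT \<Pi> I k = (SUP s. valu \<Pi> I k s)"

text \<open>
  An optimal solution has ratio 1, also if the optimum is 0. With the convention \<open>0 / 0 = 0\<close> of
  the library, any kernel whose optimum is 0 would satisfy the lifting condition.
\<close>

definition ratio :: "('i, 's) param_max_problem \<Rightarrow> 'i \<Rightarrow> nat \<Rightarrow> 's \<Rightarrow> ereal" where
  "ratio \<Pi> I k s =
     (if valu \<Pi> I k s = OPT \<Pi> I k then 1 else valu \<Pi> I k s / OPT \<Pi> I k)"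

abbreviation enc_pinst :: "('i, 's) param_max_problem \<Rightarrow> 'i \<times> nat \<Rightarrow> tree" where
  "enc_pinst \<Pi> \<equiv> enc_pair (enc_inst \<Pi>) enc_nat"

text \<open>
  The solution lifting algorithm receives the instance, the reduced instance and a solution of
  the latter.
\<close>

definition approx_preprocessing ::
  "('i, 's) param_max_problem \<Rightarrow> real \<Rightarrow> ('i \<times> nat \<Rightarrow> 'i \<times> nat) \<Rightarrow>
   (('i \<times> nat) \<times> ('i \<times> nat) \<times> 's \<Rightarrow> 's) \<Rightarrow> bool" where
  "approx_preprocessing \<Pi> \<alpha> reduce lift \<longleftrightarrow>
     poly_time_on (insts \<Pi>) (enc_pinst \<Pi>) (enc_pinst \<Pi>) reduce \<and>
     poly_time_on {(X, reduce X, s') | X s'. X \<in> insts \<Pi>}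
       (enc_pair (enc_pinst \<Pi>) (enc_pair (enc_pinst \<Pi>) (enc_sol \<Pi>))) (enc_sol \<Pi>) lift \<and>
     (\<forall>I k I' k'. (I, k) \<in> insts \<Pi> \<longrightarrow> reduce (I, k) = (I', k') \<longrightarrow>
        (I', k') \<in> insts \<Pi> \<and>
        (\<forall>s'. ereal \<alpha> * ratio \<Pi> I k (lift ((I, k), (I', k'), s')) \<ge> ratio \<Pi> I' k' s'))"

definition has_poly_approx_kernel :: "('i, 's) param_max_problem \<Rightarrow> real \<Rightarrow> bool" where
  "has_poly_approx_kernel \<Pi> \<alpha> \<longleftrightarrow>
     (\<exists>reduce lift. approx_preprocessing \<Pi> \<alpha> reduce lift \<and>
        (\<exists>g :: nat poly. \<forall>I k I' k'. (I, k) \<in> insts \<Pi> \<longrightarrow> reduce (I, k) = (I', k') \<longrightarrow>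
           inst_size \<Pi> I' + k' \<le> poly g k))"

definition admits_PSAKS :: "('i, 's) param_max_problem \<Rightarrow> bool" where
  "admits_PSAKS \<Pi> \<longleftrightarrow> (\<forall>\<alpha>>1. has_poly_approx_kernel \<Pi> \<alpha>)"

section \<open>Disjoint Factors\<close>

text \<open>A factor is given by its first and its last position, counted from 0.\<close>

definition is_factor :: "'a list \<Rightarrow> nat \<times> nat \<Rightarrow> bool" where
  "is_factor L f \<longleftrightarrow> fst f < snd f \<and> snd f < length L \<and> L ! fst f = L ! snd f"

definition disjoint_factors :: "'a list \<Rightarrow> (nat \<times> nat) set \<Rightarrow> bool" where
  "disjoint_factors L S \<longleftrightarrow>
     (\<forall>f\<in>S. is_factor L f) \<and>
     (\<forall>f\<in>S. \<forall>g\<in>S. f \<noteq> g \<longrightarrow>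
        {fst f..snd f} \<inter> {fst g..snd g} = {} \<and> L ! fst f \<noteq> L ! fst g)"

text \<open>The value does not depend on the second argument, the size of the alphabet.\<close>

definition DF :: "'a list \<Rightarrow> nat \<Rightarrow> (nat \<times> nat) set \<Rightarrow> ereal" where
  "DF L k S = (if disjoint_factors L S then ereal (real (card S)) else - \<infinity>)"

text \<open>
  The alphabet of size \<open>k\<close> is \<open>{0, \<dots>, k - 1}\<close>; it may contain letters that do not occur in the
  string. Algorithms handle a set of factors as a list of its elements, in any order and
  possibly with repetitions.
\<close>

definition Disjoint_Factors :: "(nat list, (nat \<times> nat) list) param_max_problem" where
  "Disjoint_Factors = \<lparr>
     insts = {(L, k). set L \<subseteq> {..<k}},
     valu = (\<lambda>L k s. DF L k (set s)),
     enc_inst = enc_list enc_nat,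
     enc_sol = enc_list (enc_pair enc_nat enc_nat)\<rparr>"

end

(* A word w of distinct letters is a solution of L iff the doubled word w1 w1 w2 w2 ... is a
   subsequence of L. The kernel is a subsequence L' of L over the same alphabet, so solutions are
   lifted along an embedding of L' into L, and only OPT(L) <= \<alpha> OPT(L') has to be shown.

   Cut L greedily into blocks: a block is complete once it offers t disjoint factors of alive
   letters, where t = 2 q^2 is a constant; these t letters form the word T of the block. A letter is
   alive until it occurs in the words of 4 k blocks; occurrences of dead letters are deleted. So there
   are polynomially many blocks, and each is replaced by a subsequence of polynomial length that
   contains the same words of length at most 2 t + 2. A solution visits a block in such a short
   word: a factor that starts earlier, at most t factors inside, a factor that ends later.

   The only loss are the letters K that the solution uses where they are dead. Each letter of K lies
   in the word T of at least 2 k blocks that the rest of the solution does not touch. Group these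
   blocks by the factor that runs over them and choose a maximal family G of groups that
   covers at least q |G| letters of K. Giving up the factors of G frees T in their blocks and
   recovers the letters they cover. By double counting, at most OPT(L) / q letters of K stay
   uncovered, because a block outside G contributes at most q of them to the t letters of its
   word. In total at most 2 OPT(L) / q letters are lost. *)

theory Submission
  imports Defs "HOL-Library.Sublist"
begin

section \<open>Closure properties of polynomial time\<close>

definition pbd :: "('a \<Rightarrow> tree) \<Rightarrow> ('a \<Rightarrow> nat) \<Rightarrow> bool" where
  "pbd e h \<longleftrightarrow> (\<exists>c::nat poly. \<forall>x. h x \<le> poly c (tsize (e x)))"

lemma poly_nat_mono: "x \<le> y \<Longrightarrow> poly c x \<le> poly c y" for c :: "nat poly"
  by (induction c) (auto intro!: add_mono mult_mono)

lemma pbd_mono: "pbd e g \<Longrightarrow> (\<And>x. h x \<le> g x) \<Longrightarrow> pbd e h"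
  unfolding pbd_def by (meson le_trans)

lemma pbd_size: "pbd e (\<lambda>x. tsize (e x))"
  unfolding pbd_def by (rule exI[of _ "[:0, 1:]"]) auto

lemma pbd_const: "pbd e (\<lambda>x. n)"
  unfolding pbd_def by (rule exI[of _ "[:n:]"]) auto

lemma pbd_add: "pbd e g \<Longrightarrow> pbd e h \<Longrightarrow> pbd e (\<lambda>x. g x + h x)"
  unfolding pbd_def by (metis add_mono poly_add)

lemma pbd_mult: "pbd e g \<Longrightarrow> pbd e h \<Longrightarrow> pbd e (\<lambda>x. g x * h x)"
  unfolding pbd_def by (metis mult_le_mono poly_mult)

lemma pbd_Suc: "pbd e g \<Longrightarrow> pbd e (\<lambda>x. Suc (g x))"
  using pbd_add[OF _ pbd_const[of e 1]] by simp

lemma pbd_power: "pbd e g \<Longrightarrow> pbd e (\<lambda>x. g x ^ n)"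
  by (induction n) (auto intro: pbd_const pbd_mult)

lemma pbd_poly:
  assumes "pbd e h"
  shows "pbd e (\<lambda>x. poly c (h x))"
proof -
  from assms obtain d where d: "\<And>x. h x \<le> poly d (tsize (e x))"
    unfolding pbd_def by blast
  have "poly c (h x) \<le> poly (pcompose c d) (tsize (e x))" for x
    using poly_nat_mono[OF d[of x], of c] by (simp add: poly_pcompose)
  then show ?thesis unfolding pbd_def by blast
qed

lemma pbd_comp:
  assumes "pbd e' h" "pbd e (\<lambda>x. tsize (e' (f x)))"
  shows "pbd e (\<lambda>x. h (f x))"
proof -
  from assms(1) obtain c where c: "\<And>x. h x \<le> poly c (tsize (e' x))"
    unfolding pbd_def by blast
  show ?thesis by (rule pbd_mono[OF pbd_poly[OF assms(2)] c])
qed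

lemmas pbd_intros = pbd_const pbd_size pbd_add pbd_mult pbd_Suc pbd_power

abbreviation ptime :: "('a \<Rightarrow> tree) \<Rightarrow> ('b \<Rightarrow> tree) \<Rightarrow> ('a \<Rightarrow> 'b) \<Rightarrow> bool" where
  "ptime \<equiv> poly_time_on UNIV"

lemma ptimeI:
  assumes "\<And>x. \<exists>t\<le>T x. exec p (e x) (e' (f x)) t" "pbd e T"
  shows "ptime e e' f"
proof -
  from assms(2) obtain c where "\<And>x. T x \<le> poly c (tsize (e x))"
    unfolding pbd_def by blast
  with assms(1) show ?thesis
    unfolding poly_time_on_def by (meson le_trans)
qed

lemma ptimeE:
  assumes "ptime e e' f"
  obtains p T where "\<And>x. exec p (e x) (e' (f x)) (T x)" "pbd e T"
    "pbd e (\<lambda>x. tsize (e' (f x)))"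
proof -
  from assms obtain p c where
    pc: "\<forall>x. \<exists>t. exec p (e x) (e' (f x)) t \<and> t \<le> poly c (tsize (e x))"
    unfolding poly_time_on_def by blast
  then obtain T where T: "\<And>x. exec p (e x) (e' (f x)) (T x) \<and> T x \<le> poly c (tsize (e x))"
    by metis
  then have B: "pbd e T" unfolding pbd_def by blast
  have "tsize (e' (f x)) \<le> T x" for x using T[of x] exec_tsize by blast
  from that[OF _ B pbd_mono[OF B this]] T show ?thesis by blast
qed

lemma ptime_pbd: "ptime e e' f \<Longrightarrow> pbd e (\<lambda>x. tsize (e' (f x)))"
  by (erule ptimeE)

lemma ptime_id: "ptime e e (\<lambda>x. x)"
  by (rule ptimeI[of "\<lambda>x. tsize (e x)" Skip]) (auto intro: exec.Skip pbd_size)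

lemma ptime_comp:
  assumes "ptime e1 e2 g" "ptime e e1 f"
  shows "ptime e e2 (\<lambda>x. g (f x))"
proof -
  obtain p T where p: "\<And>x. exec p (e x) (e1 (f x)) (T x)" "pbd e T" "pbd e (\<lambda>x. tsize (e1 (f x)))"
    using ptimeE[OF assms(2)] by blast
  obtain q U where q: "\<And>x. exec q (e1 x) (e2 (g x)) (U x)" "pbd e1 U"
    using ptimeE[OF assms(1)] by blast
  show ?thesis
    by (rule ptimeI[of "\<lambda>x. tsize (e x) + T x + U (f x)" "Then p q"])
      (auto intro!: exec.Then p q pbd_intros pbd_comp[OF q(2)])
qed

lemma ptime_pair:
  assumes "ptime e a f" "ptime e b g"
  shows "ptime e (enc_pair a b) (\<lambda>x. (f x, g x))"
proof -
  obtain p T where p: "\<And>x. exec p (e x) (a (f x)) (T x)" "pbd e T"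
    using ptimeE[OF assms(1)] by blast
  obtain q U where q: "\<And>x. exec q (e x) (b (g x)) (U x)" "pbd e U"
    using ptimeE[OF assms(2)] by blast
  show ?thesis
    by (rule ptimeI[of "\<lambda>x. tsize (e x) + T x + U x" "Join p q"])
      (auto intro!: exec.Join p q pbd_intros)
qed

lemma ptime_fst: "ptime e (enc_pair a b) f \<Longrightarrow> ptime e a (\<lambda>x. fst (f x))"
proof (erule ptime_comp[rotated], rule ptimeI[of "\<lambda>x. tsize (enc_pair a b x)" Head])
  fix x :: "'b \<times> 'c"
  show "\<exists>t\<le>tsize (enc_pair a b x). exec Head (enc_pair a b x) (a (fst x)) t"
    by (cases x) (auto intro!: exI[of _ "Suc (_ + _)"] exec.Head_Node[simplified])
qed (rule pbd_size)

lemma ptime_snd: "ptime e (enc_pair a b) f \<Longrightarrow> ptime e b (\<lambda>x. snd (f x))"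
proof (erule ptime_comp[rotated], rule ptimeI[of "\<lambda>x. tsize (enc_pair a b x)" Tail])
  fix x :: "'b \<times> 'c"
  show "\<exists>t\<le>tsize (enc_pair a b x). exec Tail (enc_pair a b x) (b (snd x)) t"
    by (cases x) (auto intro!: exI[of _ "Suc (_ + _)"] exec.Tail_Node[simplified])
qed (rule pbd_size)

fun const_prog :: "tree \<Rightarrow> prog" where
  "const_prog Leaf = ToLeaf"
| "const_prog (Node l r) = Join (const_prog l) (const_prog r)"

lemma const_prog: "exec (const_prog y) x y (tsize y * tsize x)"
proof (induction y)
  case (Node l r)
  then show ?case using exec.Join[OF Node] by (simp add: algebra_simps)
qed (auto intro: exec.ToLeaf)

lemma ptime_const: "ptime e e' (\<lambda>x. c)"
  by (rule ptimeI[of "\<lambda>x. tsize (e' c) * tsize (e x)" "const_prog (e' c)"])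
    (auto intro!: const_prog pbd_intros)

lemma ptime_Cons:
  assumes "ptime e a f" "ptime e (enc_list a) g"
  shows "ptime e (enc_list a) (\<lambda>x. f x # g x)"
  using ptime_pair[OF assms] unfolding poly_time_on_def by simp

lemma ptime_case_list:
  assumes f: "ptime e (enc_list a) f" and g: "ptime e b g"
    and h: "ptime (enc_pair e (enc_pair a (enc_list a))) b (\<lambda>p. h (fst p) (fst (snd p)) (snd (snd p)))"
  shows "ptime e b (\<lambda>x. case f x of [] \<Rightarrow> g x | y # ys \<Rightarrow> h x y ys)"
proof -
  obtain p T where p: "\<And>x. exec p (e x) (enc_list a (f x)) (T x)" "pbd e T"
      "pbd e (\<lambda>x. tsize (enc_list a (f x)))"
    using ptimeE[OF f] by blast
  obtain q U where q: "\<And>x. exec q (e x) (b (g x)) (U x)" "pbd e U"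
    using ptimeE[OF g] by blast
  obtain r V where r: "\<And>x. exec r (enc_pair e (enc_pair a (enc_list a)) x)
      (b (h (fst x) (fst (snd x)) (snd (snd x)))) (V x)"
      "pbd (enc_pair e (enc_pair a (enc_list a))) V"
    using ptimeE[OF h] by blast
  obtain c where c: "\<And>x. V x \<le> poly c (tsize (enc_pair e (enc_pair a (enc_list a)) x))"
    using r(2) unfolding pbd_def by blast
  let ?S = "\<lambda>x. Suc (tsize (e x) + tsize (enc_list a (f x)))"
  let ?W = "\<lambda>x. tsize (e x) + T x + (U x + (tsize (e x) + (tsize (e x) + tsize (e x) + T x) + poly c (?S x)))"
  show ?thesis
  proof (rule ptimeI[of ?W "Cond p (Then (Join Skip p) r) q"])
    show "pbd e ?W" by (intro pbd_intros pbd_poly p q)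
    fix x
    show "\<exists>t\<le>?W x. exec (Cond p (Then (Join Skip p) r) q) (e x)
       (b (case f x of [] \<Rightarrow> g x | y # ys \<Rightarrow> h x y ys)) t"
    proof (cases "f x")
      case Nil
      with p(1)[of x] have "exec p (e x) Leaf (T x)" by simp
      from exec.Cond_False[OF this q(1)] Nil show ?thesis
        by (intro exI[of _ "tsize (e x) + T x + U x"]) auto
    next
      case (Cons y ys)
      with p(1)[of x] have P: "exec p (e x) (Node (a y) (enc_list a ys)) (T x)" by simp
      have "exec (Join Skip p) (e x) (enc_pair e (enc_pair a (enc_list a)) (x, y, ys))
          (tsize (e x) + tsize (e x) + T x)"
        using exec.Join[OF exec.Skip P] by simp
      from exec.Cond_True[OF P exec.Then[OF this r(1)]] Cons c[of "(x, y, ys)"]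
      show ?thesis by (intro exI conjI[rotated]) auto
    qed
  qed
qed

definition enc_bool :: "bool \<Rightarrow> tree" where
  "enc_bool b = (if b then Node Leaf Leaf else Leaf)"

lemma ptime_if:
  assumes "ptime e enc_bool c" "ptime e a f" "ptime e a g"
  shows "ptime e a (\<lambda>x. if c x then f x else g x)"
proof -
  obtain p T where p: "\<And>x. exec p (e x) (a (f x)) (T x)" "pbd e T"
    using ptimeE[OF assms(2)] by blast
  obtain q U where q: "\<And>x. exec q (e x) (a (g x)) (U x)" "pbd e U"
    using ptimeE[OF assms(3)] by blast
  obtain r V where r: "\<And>x. exec r (e x) (enc_bool (c x)) (V x)" "pbd e V"
    using ptimeE[OF assms(1)] by blast
  show ?thesis
  proof (rule ptimeI[of "\<lambda>x. tsize (e x) + V x + (T x + U x)" "Cond r p q"])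
    fix x
    show "\<exists>t\<le>tsize (e x) + V x + (T x + U x). exec (Cond r p q) (e x) (a (if c x then f x else g x)) t"
    proof (cases "c x")
      case True
      then have "exec r (e x) (Node Leaf Leaf) (V x)" using r(1)[of x] by (simp add: enc_bool_def)
      from exec.Cond_True[OF this p(1)] True show ?thesis by (intro exI conjI[rotated]) auto
    next
      case False
      then have "exec r (e x) Leaf (V x)" using r(1)[of x] by (simp add: enc_bool_def)
      from exec.Cond_False[OF this q(1)] False show ?thesis by (intro exI conjI[rotated]) auto
    qed
  qed (intro pbd_intros p q r)
qed

lemma enc_list_nth_le: "n < length ys \<Longrightarrow> tsize (a (ys ! n)) \<le> tsize (enc_list a ys)"
proof (induction ys arbitrary: n)
  case (Cons y ys)
  then show ?case by (cases n) (auto intro: le_SucI trans_le_add2)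
qed auto

definition fold_body :: "prog \<Rightarrow> prog" where
  "fold_body G = Join (Then Head Tail) (Join (Then Tail Head)
     (Then (Join (Then Tail Head) (Join (Then Head Head) (Then Tail Tail))) G))"

lemma fold_body:
  assumes "exec G (Node x (Node y z)) z' t"
  shows "\<exists>u\<le>20 * tsize (Node (Node y ys) (Node x z)) + t.
    exec (fold_body G) (Node (Node y ys) (Node x z)) (Node ys (Node x z')) u"
proof -
  let ?s = "Node (Node y ys) (Node x z)"
  note * = exec.Join[OF exec.Then[OF exec.Head_Node exec.Tail_Node]
    exec.Join[OF exec.Then[OF exec.Tail_Node exec.Head_Node]
     exec.Then[OF exec.Join[OF exec.Then[OF exec.Tail_Node exec.Head_Node]
       exec.Join[OF exec.Then[OF exec.Head_Node exec.Head_Node] exec.Then[OF exec.Tail_Node exec.Tail_Node]]] assms]]]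
  show ?thesis unfolding fold_body_def
    by (rule exI, rule conjI[OF _ *]) simp
qed

lemma fold_loop:
  assumes "\<And>y z. exec G (Node x (Node (a y) (b z))) (b (g y z)) (V y z)"
    and "\<And>n. tsize (b (fold g (take n ys) z)) \<le> B"
    and "\<And>n. n < length ys \<Longrightarrow> V (ys ! n) (fold g (take n ys) z) \<le> C"
    and "tsize (enc_list a ys) \<le> A"
  shows "\<exists>t\<le>Suc (length ys) * (C + 23 * (2 + A + tsize x + B)).
    exec (Loop Head (fold_body G)) (Node (enc_list a ys) (Node x (b z)))
      (Node Leaf (Node x (b (fold g ys z)))) t"
  using assms(2-)
proof (induction ys arbitrary: z)
  case Nil
  have "exec (Loop Head (fold_body G)) (Node Leaf (Node x (b z))) (Node Leaf (Node x (b z)))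
     (tsize (Node Leaf (Node x (b z))) + tsize (Node Leaf (Node x (b z))))"
    by (intro exec.Loop_False exec.Head_Node)
  with Nil.prems(1)[of 0] Nil.prems(3) show ?case by (intro exI conjI[rotated]) auto
next
  case (Cons y ys)
  let ?s = "Node (Node (a y) (enc_list a ys)) (Node x (b z))"
  obtain u where u: "u \<le> 20 * tsize ?s + V y z"
    "exec (fold_body G) ?s (Node (enc_list a ys) (Node x (b (g y z)))) u"
    using fold_body[OF assms(1)[of y z]] by blast
  obtain t where t: "t \<le> Suc (length ys) * (C + 23 * (2 + A + tsize x + B))"
     "exec (Loop Head (fold_body G)) (Node (enc_list a ys) (Node x (b (g y z))))
      (Node Leaf (Node x (b (fold g ys (g y z))))) t"
    using Cons.IH[of "g y z"] Cons.prems(1)[of "Suc _"] Cons.prems(2)[of "Suc _"] Cons.prems(3)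
    by auto
  have "tsize ?s \<le> 2 + A + tsize x + B" "V y z \<le> C"
    using Cons.prems(1)[of 0] Cons.prems(2)[of 0] Cons.prems(3) by auto
  with exec.Loop_True[OF exec.Head_Node u(2) t(2)] t(1) u(1) show ?case
    by (intro exI conjI[rotated]) auto
qed

lemma length_le_tsize: "length ys \<le> tsize (enc_list a ys)"
  by (induction ys) auto

lemma ptime_fold:
  assumes xs: "ptime e (enc_list a) xs" and s: "ptime e b s"
    and g: "ptime (enc_pair e (enc_pair a b)) b (\<lambda>p. g (fst p) (fst (snd p)) (snd (snd p)))"
    and B: "pbd e B" "\<And>x n. tsize (b (fold (g x) (take n (xs x)) (s x))) \<le> B x"
  shows "ptime e b (\<lambda>x. fold (g x) (xs x) (s x))"
proof -
  obtain p T where p: "\<And>x. exec p (e x) (enc_list a (xs x)) (T x)" "pbd e T"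
      "pbd e (\<lambda>x. tsize (enc_list a (xs x)))"
    using ptimeE[OF xs] by blast
  obtain q U where q: "\<And>x. exec q (e x) (b (s x)) (U x)" "pbd e U"
    using ptimeE[OF s] by blast
  obtain G V where G: "\<And>x. exec G (enc_pair e (enc_pair a b) x)
      (b (g (fst x) (fst (snd x)) (snd (snd x)))) (V x)" "pbd (enc_pair e (enc_pair a b)) V"
    using ptimeE[OF g] by blast
  obtain c where c: "\<And>x. V x \<le> poly c (tsize (enc_pair e (enc_pair a b) x))"
    using G(2) unfolding pbd_def by blast
  define A where "A x = tsize (enc_list a (xs x))" for x
  define C where "C x = poly c (2 + tsize (e x) + A x + B x)" for x
  have A: "pbd e A" using p(3) by (simp add: A_def[abs_def])
  have C: "pbd e C" unfolding C_def by (intro pbd_poly pbd_intros A B)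
  define W where "W x = tsize (e x) + (tsize (e x) + T x + (tsize (e x) + tsize (e x) + U x)) +
     (Suc (Suc (A x + (Suc (tsize (e x) + B x)))) + (Suc (A x) * (C x + 23 * (2 + A x + tsize (e x) + B x)))
     + 20 * (5 + A x + tsize (e x) + B x))" for x
  show ?thesis
  proof (rule ptimeI[of W "Then (Join p (Join Skip q)) (Then (Loop Head (fold_body G)) (Then Tail Tail))"])
    show "pbd e W" unfolding W_def by (intro pbd_intros p q A B C)
    fix x
    have V: "V (x, xs x ! n, fold (g x) (take n (xs x)) (s x)) \<le> C x" if "n < length (xs x)" for n
    proof -
      have "tsize (a (xs x ! n)) \<le> A x"
        using enc_list_nth_le[OF that] unfolding A_def .
      then show ?thesis unfolding C_def
        using B(2)[of x n] by (intro order.trans[OF c] poly_nat_mono) auto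
    qed
    obtain t where t: "t \<le> Suc (length (xs x)) * (C x + 23 * (2 + A x + tsize (e x) + B x))"
     "exec (Loop Head (fold_body G)) (Node (enc_list a (xs x)) (Node (e x) (b (s x))))
      (Node Leaf (Node (e x) (b (fold (g x) (xs x) (s x))))) t"
      using fold_loop[of G "e x" a b "g x" "\<lambda>y z. V (x, y, z)" "xs x" "s x" "B x" "C x" "A x"]
        G(1)[of "(x, _, _)"] B(2) V by (auto simp: A_def)
    have "Suc (length (xs x)) \<le> Suc (A x)" unfolding A_def using length_le_tsize by simp
    then have t': "t \<le> Suc (A x) * (C x + 23 * (2 + A x + tsize (e x) + B x))"
      using t(1) mult_le_mono1 order.trans by blast
    have sz: "tsize (b (s x)) \<le> B x" "tsize (b (fold (g x) (xs x) (s x))) \<le> B x"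
      using B(2)[of x 0] B(2)[of x "length (xs x)"] by auto
    show "\<exists>t\<le>W x. exec (Then (Join p (Join Skip q)) (Then (Loop Head (fold_body G)) (Then Tail Tail))) (e x)
      (b (fold (g x) (xs x) (s x))) t"
      apply (rule exI, rule conjI[rotated])
       apply (rule exec.Then[OF exec.Join[OF p(1) exec.Join[OF exec.Skip q(1)]] exec.Then[OF t(2) exec.Then[OF exec.Tail_Node exec.Tail_Node]]])
      using t' sz unfolding W_def A_def[symmetric] by (simp add: A_def[symmetric])
  qed
qed

lemma enc_list_size: "tsize (enc_list a ys) = Suc (\<Sum>y\<leftarrow>ys. Suc (tsize (a y)))"
  by (induction ys) auto

lemma enc_list_size_append:
  "tsize (enc_list a (xs @ ys)) + 1 = tsize (enc_list a xs) + tsize (enc_list a ys)"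
  by (simp add: enc_list_size)

lemma enc_list_take_le: "tsize (enc_list a (take n ys)) \<le> tsize (enc_list a ys)"
  using enc_list_size_append[of a "take n ys" "drop n ys"] by (simp add: enc_list_size)

lemma enc_list_drop_le: "tsize (enc_list a (drop n ys)) \<le> tsize (enc_list a ys)"
  using enc_list_size_append[of a "take n ys" "drop n ys"] by (simp add: enc_list_size)

lemma enc_list_elem_le: "y \<in> set ys \<Longrightarrow> tsize (a y) \<le> tsize (enc_list a ys)"
  by (metis enc_list_nth_le in_set_conv_nth)

lemma enc_list_size_le:
  assumes "\<And>y. y \<in> set ys \<Longrightarrow> tsize (a y) \<le> M" "length ys \<le> n"
  shows "tsize (enc_list a ys) \<le> Suc (n * Suc M)"
proof -
  have "tsize (enc_list a ys) \<le> Suc (length ys * Suc M)"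
    using assms(1)
  proof (induction ys)
    case (Cons y ys)
    have "tsize (a y) \<le> M" "tsize (enc_list a ys) \<le> Suc (length ys * Suc M)"
      using Cons by simp_all
    then show ?case by simp
  qed simp
  also have "\<dots> \<le> Suc (n * Suc M)" using assms(2) mult_le_mono1 by blast
  finally show ?thesis .
qed

lemma enc_nat_size: "tsize (enc_nat n) = 2 * n + 1"
  by (induction n) auto

lemma ptime_case_const_list:
  assumes "ptime e (enc_list a) f" "ptime e b g" "ptime e b h"
  shows "ptime e b (\<lambda>x. case f x of [] \<Rightarrow> g x | _ # _ \<Rightarrow> h x)"
  using assms(1,2) by (rule ptime_case_list) (rule ptime_comp[OF assms(3)], rule ptime_fst, rule ptime_id)

lemma ptime_not:
  assumes "ptime e enc_bool f"
  shows "ptime e enc_bool (\<lambda>x. \<not> f x)"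
proof -
  have "(\<lambda>x. \<not> f x) = (\<lambda>x. if f x then False else True)" by auto
  then show ?thesis by (simp only: ptime_if assms ptime_const)
qed

lemma ptime_conj:
  assumes "ptime e enc_bool f" "ptime e enc_bool g"
  shows "ptime e enc_bool (\<lambda>x. f x \<and> g x)"
proof -
  have "(\<lambda>x. f x \<and> g x) = (\<lambda>x. if f x then g x else False)" by auto
  then show ?thesis by (simp only: ptime_if assms ptime_const)
qed

lemma ptime_tl:
  assumes "ptime e (enc_list a) f"
  shows "ptime e (enc_list a) (\<lambda>x. tl (f x))"
proof -
  have "ptime e (enc_list a) (\<lambda>x. case f x of [] \<Rightarrow> [] | y # ys \<Rightarrow> ys)"
    by (intro ptime_case_list[OF assms] ptime_const ptime_snd) (rule ptime_id)
  then show ?thesis by (simp add: tl_def)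
qed

lemma ptime_Nil_eq:
  assumes "ptime e (enc_list a) f"
  shows "ptime e enc_bool (\<lambda>x. f x = [])"
proof -
  have "ptime e enc_bool (\<lambda>x. case f x of [] \<Rightarrow> True | y # ys \<Rightarrow> False)"
    by (intro ptime_case_const_list[OF assms] ptime_const)
  moreover have "(case f x of [] \<Rightarrow> True | y # ys \<Rightarrow> False) = (f x = [])" for x
    by (cases "f x") auto
  ultimately show ?thesis by simp
qed

text \<open>A unary number is a list of units, so that loops over numbers are folds.\<close>

definition enc_unit :: "unit \<Rightarrow> tree" where
  "enc_unit u = Leaf"

lemma enc_list_unit: "enc_list enc_unit us = enc_nat (length us)"
  by (induction us) (auto simp: enc_unit_def)

lemma ptime_replicate_unit:
  "ptime e enc_nat f \<Longrightarrow> ptime e (enc_list enc_unit) (\<lambda>x. replicate (f x) ())"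
  by (simp add: poly_time_on_def enc_list_unit)

lemma ptime_length_unit:
  "ptime e (enc_list enc_unit) f \<Longrightarrow> ptime e enc_nat (\<lambda>x. length (f x))"
  by (simp add: poly_time_on_def enc_list_unit)

lemma ptime_Suc: "ptime e enc_nat f \<Longrightarrow> ptime e enc_nat (\<lambda>x. Suc (f x))"
  using ptime_length_unit[OF ptime_Cons[OF ptime_const ptime_replicate_unit], of e f "()"] by simp

lemma ptime_pred: "ptime e enc_nat f \<Longrightarrow> ptime e enc_nat (\<lambda>x. f x - 1)"
  using ptime_length_unit[OF ptime_tl[OF ptime_replicate_unit], of e f] by simp

lemma ptime_eq_0: "ptime e enc_nat f \<Longrightarrow> ptime e enc_bool (\<lambda>x. f x = 0)"
  using ptime_Nil_eq[OF ptime_replicate_unit, of e f] by simp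

lemmas ptime_basic = ptime_id ptime_const ptime_fst ptime_snd ptime_pair ptime_Cons ptime_if
  ptime_not ptime_conj ptime_tl ptime_Nil_eq ptime_Suc ptime_eq_0

lemma ptime_add:
  assumes "ptime e enc_nat f" "ptime e enc_nat g"
  shows "ptime e enc_nat (\<lambda>x. f x + g x)"
proof -
  have fold: "fold (\<lambda>_. Suc) us m = length us + m" for us :: "unit list" and m
    by (induction us arbitrary: m) auto
  have "ptime e enc_nat (\<lambda>x. fold (\<lambda>_. Suc) (replicate (f x) ()) (g x))"
  proof (rule ptime_fold[OF ptime_replicate_unit[OF assms(1)] assms(2)])
    show "pbd e (\<lambda>x. tsize (enc_nat (f x)) + tsize (enc_nat (g x)))"
      by (intro pbd_add ptime_pbd[OF assms(1)] ptime_pbd[OF assms(2)])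
    show "tsize (enc_nat (fold (\<lambda>_. Suc) (take n (replicate (f x) ())) (g x)))
      \<le> tsize (enc_nat (f x)) + tsize (enc_nat (g x))" for x n
      unfolding fold enc_nat_size by simp
  qed (rule ptime_basic)+
  then show ?thesis by (simp only: fold length_replicate)
qed

lemma ptime_diff:
  assumes "ptime e enc_nat f" "ptime e enc_nat g"
  shows "ptime e enc_nat (\<lambda>x. f x - g x)"
proof -
  have fold: "fold (\<lambda>_ m. m - 1) us m = m - length us" for us :: "unit list" and m
    by (induction us arbitrary: m) auto
  have "ptime e enc_nat (\<lambda>x. fold (\<lambda>_ m. m - 1) (replicate (g x) ()) (f x))"
  proof (rule ptime_fold[OF ptime_replicate_unit[OF assms(2)] assms(1) _ ptime_pbd[OF assms(1)]])
    show "tsize (enc_nat (fold (\<lambda>_ m. m - 1) (take n (replicate (g x) ())) (f x))) \<le> tsize (enc_nat (f x))" for x n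
      unfolding fold enc_nat_size by simp
  qed (rule ptime_basic ptime_pred)+
  then show ?thesis by (simp only: fold length_replicate)
qed

lemma ptime_nat_le:
  assumes "ptime e enc_nat f" "ptime e enc_nat g"
  shows "ptime e enc_bool (\<lambda>x. f x \<le> g x)"
  using ptime_eq_0[OF ptime_diff[OF assms]] by simp

lemma ptime_nat_less:
  assumes "ptime e enc_nat f" "ptime e enc_nat g"
  shows "ptime e enc_bool (\<lambda>x. f x < g x)"
  using ptime_not[OF ptime_nat_le[OF assms(2,1)]] by (simp add: not_le)

lemma ptime_nat_eq:
  assumes "ptime e enc_nat f" "ptime e enc_nat g"
  shows "ptime e enc_bool (\<lambda>x. f x = g x)"
  using ptime_conj[OF ptime_nat_le[OF assms] ptime_nat_le[OF assms(2,1)]] by (simp add: eq_iff)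

lemma ptime_rev:
  assumes "ptime e (enc_list a) f"
  shows "ptime e (enc_list a) (\<lambda>x. rev (f x))"
proof -
  have "ptime e (enc_list a) (\<lambda>x. fold Cons (f x) [])"
  proof (rule ptime_fold[OF assms ptime_const _ ptime_pbd[OF assms]])
    show "tsize (enc_list a (fold Cons (take n (f x)) [])) \<le> tsize (enc_list a (f x))" for x n
      using enc_list_take_le[of a n "f x"] by (simp add: enc_list_size fold_Cons_rev rev_map[symmetric])
  qed (rule ptime_basic)+
  then show ?thesis by (simp add: rev_conv_fold)
qed

lemma ptime_foldr:
  assumes xs: "ptime e (enc_list a) xs" and s: "ptime e b s"
    and g: "ptime (enc_pair e (enc_pair a b)) b (\<lambda>p. g (fst p) (fst (snd p)) (snd (snd p)))"
    and B: "pbd e B" "\<And>x n. tsize (b (foldr (g x) (drop n (xs x)) (s x))) \<le> B x"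
  shows "ptime e b (\<lambda>x. foldr (g x) (xs x) (s x))"
proof -
  have "ptime e b (\<lambda>x. fold (g x) (rev (xs x)) (s x))"
    using B(2) by (intro ptime_fold[OF ptime_rev[OF xs] s g B(1)]) (simp add: take_rev flip: foldr_conv_fold)
  then show ?thesis by (simp add: foldr_conv_fold)
qed

lemma ptime_list_of_foldr:
  assumes "ptime e (enc_list a) xs" "ptime e (enc_list b) s"
    and "ptime (enc_pair e (enc_pair a (enc_list b))) (enc_list b) (\<lambda>p. g (fst p) (fst (snd p)) (snd (snd p)))"
    and M: "pbd e M"
      "\<And>x n v. v \<in> set (foldr (g x) (drop n (xs x)) (s x)) \<Longrightarrow> tsize (b v) \<le> M x"
    and N: "pbd e N" "\<And>x n. length (foldr (g x) (drop n (xs x)) (s x)) \<le> N x"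
  shows "ptime e (enc_list b) (\<lambda>x. foldr (g x) (xs x) (s x))"
  using M N by (intro ptime_foldr[OF assms(1-3), where B = "\<lambda>x. Suc (N x * Suc (M x))"]
      pbd_intros enc_list_size_le)

lemma ptime_comp2:
  assumes "ptime (enc_pair e1 e2) e' (\<lambda>p. h (fst p) (snd p))" "ptime e e1 f" "ptime e e2 g"
  shows "ptime e e' (\<lambda>x. h (f x) (g x))"
  using ptime_comp[OF assms(1) ptime_pair[OF assms(2,3)]] by simp

lemma pbd_length: "ptime e (enc_list a) xs \<Longrightarrow> pbd e (\<lambda>x. length (xs x))"
  by (rule pbd_mono[where g = "\<lambda>x. tsize (enc_list a (xs x))"]) (simp_all add: ptime_pbd length_le_tsize)

lemma ptime_map:
  assumes xs: "ptime e (enc_list a) xs" and h: "ptime (enc_pair e a) b (\<lambda>p. h (fst p) (snd p))"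
  shows "ptime e (enc_list b) (\<lambda>x. map (h x) (xs x))"
proof -
  obtain c where c: "\<And>x y. tsize (b (h x y)) \<le> poly c (Suc (tsize (e x) + tsize (a y)))"
    using ptime_pbd[OF h] unfolding pbd_def by auto
  have map: "foldr (\<lambda>y zs. f y # zs) ys [] = map f ys" for f :: "'b \<Rightarrow> 'c" and ys
    by (induction ys) auto
  let ?M = "\<lambda>x. poly c (Suc (tsize (e x) + tsize (enc_list a (xs x))))"
  have "ptime e (enc_list b) (\<lambda>x. foldr (\<lambda>y zs. h x y # zs) (xs x) [])"
  proof (rule ptime_list_of_foldr[OF xs ptime_const, where M = ?M and N = "\<lambda>x. length (xs x)"])
    show "ptime (enc_pair e (enc_pair a (enc_list b))) (enc_list b)
        (\<lambda>p. h (fst p) (fst (snd p)) # snd (snd p))"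
      by (intro ptime_Cons ptime_comp2[OF h] ptime_fst ptime_snd) (rule ptime_id)+
    show "pbd e ?M" by (intro pbd_poly pbd_intros ptime_pbd[OF xs])
    fix x n v assume "v \<in> set (foldr (\<lambda>y zs. h x y # zs) (drop n (xs x)) [])"
    then obtain y where y: "y \<in> set (xs x)" "v = h x y"
      unfolding map by (auto dest: in_set_dropD)
    have "tsize (b v) \<le> poly c (Suc (tsize (e x) + tsize (a y)))" unfolding y(2) by (rule c)
    also have "\<dots> \<le> ?M x" using enc_list_elem_le[OF y(1), of a] by (intro poly_nat_mono) simp
    finally show "tsize (b v) \<le> ?M x" .
  qed (simp_all add: map pbd_length[OF xs])
  then show ?thesis by (simp add: map)
qed

lemma ptime_filter:
  assumes xs: "ptime e (enc_list a) xs" and P: "ptime (enc_pair e a) enc_bool (\<lambda>p. P (fst p) (snd p))"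
  shows "ptime e (enc_list a) (\<lambda>x. filter (P x) (xs x))"
proof -
  have filter: "foldr (\<lambda>y zs. if f y then y # zs else zs) ys [] = filter f ys" for f :: "'b \<Rightarrow> bool" and ys
    by (induction ys) auto
  have "ptime e (enc_list a) (\<lambda>x. foldr (\<lambda>y zs. if P x y then y # zs else zs) (xs x) [])"
  proof (rule ptime_list_of_foldr[OF xs ptime_const, where M = "\<lambda>x. tsize (enc_list a (xs x))"
        and N = "\<lambda>x. length (xs x)"])
    show "ptime (enc_pair e (enc_pair a (enc_list a))) (enc_list a)
        (\<lambda>p. if P (fst p) (fst (snd p)) then fst (snd p) # snd (snd p) else snd (snd p))"
      by (intro ptime_if ptime_Cons ptime_comp2[OF P] ptime_fst ptime_snd) (rule ptime_id)+
    show "tsize (a v) \<le> tsize (enc_list a (xs x))"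
      if "v \<in> set (foldr (\<lambda>y zs. if P x y then y # zs else zs) (drop n (xs x)) [])" for x n v
      using that unfolding filter by (auto intro: enc_list_elem_le dest: in_set_dropD)
    show "length (foldr (\<lambda>y zs. if P x y then y # zs else zs) (drop n (xs x)) []) \<le> length (xs x)" for x n
      unfolding filter using length_filter_le[of "P x" "drop n (xs x)"] by simp
  qed (rule ptime_pbd[OF xs] pbd_length[OF xs])+
  then show ?thesis by (simp add: filter)
qed

lemma ptime_bex:
  assumes "ptime e (enc_list a) xs" "ptime (enc_pair e a) enc_bool (\<lambda>p. P (fst p) (snd p))"
  shows "ptime e enc_bool (\<lambda>x. \<exists>y\<in>set (xs x). P x y)"
  using ptime_not[OF ptime_Nil_eq[OF ptime_filter[OF assms]]] by (simp add: filter_empty_conv)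

lemma ptime_append:
  assumes "ptime e (enc_list a) f" "ptime e (enc_list a) g"
  shows "ptime e (enc_list a) (\<lambda>x. f x @ g x)"
proof -
  have foldr: "foldr Cons xs ys = xs @ ys" for xs ys :: "'b list"
    by (induction xs) auto
  have "ptime e (enc_list a) (\<lambda>x. foldr Cons (f x) (g x))"
  proof (rule ptime_foldr[OF assms, where B = "\<lambda>x. tsize (enc_list a (f x)) + tsize (enc_list a (g x))"])
    show "tsize (enc_list a (foldr (#) (drop n (f x)) (g x))) \<le> tsize (enc_list a (f x)) + tsize (enc_list a (g x))" for x n
      using enc_list_size_append[of a "drop n (f x)" "g x"] enc_list_drop_le[of a n "f x"]
      by (simp add: foldr)
  qed (rule ptime_basic pbd_add ptime_pbd[OF assms(1)] ptime_pbd[OF assms(2)])+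
  then show ?thesis by (simp add: foldr)
qed

lemma ptime_length:
  assumes "ptime e (enc_list a) f"
  shows "ptime e enc_nat (\<lambda>x. length (f x))"
  using ptime_length_unit[OF ptime_map[OF assms, where b = enc_unit and h = "\<lambda>_ _. ()", OF ptime_const]]
  by simp

lemma ptime_count_list:
  assumes "ptime e (enc_list enc_nat) f" "ptime e enc_nat g"
  shows "ptime e enc_nat (\<lambda>x. count_list (f x) (g x))"
proof -
  have "ptime e enc_nat (\<lambda>x. length (filter ((=) (g x)) (f x)))"
    by (rule ptime_length ptime_filter[OF assms(1)] ptime_nat_eq ptime_basic ptime_comp[OF assms(2)])+
  then show ?thesis by (simp add: count_list_eq_length_filter)
qed

lemma ptime_drop:
  assumes "ptime e (enc_list a) f" "ptime e enc_nat g"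
  shows "ptime e (enc_list a) (\<lambda>x. drop (g x) (f x))"
proof -
  have fold: "fold (\<lambda>_. tl) us ys = drop (length us) ys" for us :: "unit list" and ys :: "'b list"
    by (induction us arbitrary: ys) (auto simp: drop_Suc)
  have "ptime e (enc_list a) (\<lambda>x. fold (\<lambda>_. tl) (replicate (g x) ()) (f x))"
  proof (rule ptime_fold[OF ptime_replicate_unit[OF assms(2)] assms(1) _ ptime_pbd[OF assms(1)]])
    show "tsize (enc_list a (fold (\<lambda>_. tl) (take n (replicate (g x) ())) (f x))) \<le> tsize (enc_list a (f x))" for x n
      unfolding fold by (rule enc_list_drop_le)
  qed (rule ptime_basic)+
  then show ?thesis by (simp only: fold length_replicate)
qed

lemma ptime_list_eq:
  fixes f g :: "'a \<Rightarrow> 'b list"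
  assumes f: "ptime e (enc_list a) f" and g: "ptime e (enc_list a) g"
    and eq: "ptime (enc_pair a a) enc_bool (\<lambda>p. fst p = snd p)"
  shows "ptime e enc_bool (\<lambda>x. f x = g x)"
proof -
  define h :: "'b \<Rightarrow> bool \<times> 'b list \<Rightarrow> bool \<times> 'b list" where "h = (\<lambda>y s. (fst s \<and> (\<exists>z\<in>set (case snd s of [] \<Rightarrow> [] | z # zs \<Rightarrow> [z]). y = z), tl (snd s)))"
  have h: "h y (b, []) = (False, [])" "h y (b, z # zs) = (b \<and> y = z, zs)" for y z b zs
    by (auto simp: h_def)
  have fold: "fold h xs (b, ys) = (b \<and> length xs \<le> length ys \<and> take (length xs) ys = xs, drop (length xs) ys)"
    for xs ys b
  proof (induction xs arbitrary: b ys)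
    case (Cons x xs)
    show ?case by (cases ys) (auto simp: Cons.IH h)
  qed simp
  have "ptime e (enc_pair enc_bool (enc_list a)) (\<lambda>x. fold h (f x) (True, g x))"
  proof (rule ptime_fold[OF f, where B = "\<lambda>x. 4 + tsize (enc_list a (g x))"])
    show "ptime e (enc_pair enc_bool (enc_list a)) (\<lambda>x. (True, g x))" by (rule ptime_basic g)+
    let ?E = "enc_pair e (enc_pair a (enc_pair enc_bool (enc_list a)))"
    have *: "ptime ?E (enc_list a) (\<lambda>p. case snd (snd (snd p)) of [] \<Rightarrow> [] | z # zs \<Rightarrow> [z])"
      by (rule ptime_case_list) (rule ptime_basic)+
    show "ptime ?E (enc_pair enc_bool (enc_list a)) (\<lambda>p. h (fst (snd p)) (snd (snd p)))"
      unfolding h_def by (intro ptime_basic ptime_bex[OF *] ptime_comp2[OF eq]; (rule ptime_id))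
    show "tsize (enc_pair enc_bool (enc_list a) (fold h (take n (f x)) (True, g x))) \<le> 4 + tsize (enc_list a (g x))" for x n
    proof -
      have "tsize (enc_bool b) \<le> 3" for b by (simp add: enc_bool_def)
      then show ?thesis
        unfolding fold enc_pair.simps tsize.simps
        using enc_list_drop_le[of a "length (take n (f x))" "g x"] by (simp add: add_mono)
    qed
  qed (intro pbd_add pbd_const ptime_pbd[OF g])
  note F = this
  have "ptime e enc_bool (\<lambda>x. fst (fold h (f x) (True, g x)) \<and> snd (fold h (f x) (True, g x)) = [])"
    by (rule ptime_conj[OF ptime_fst[OF F] ptime_Nil_eq[OF ptime_snd[OF F]]])
  moreover have "fst (fold h (f x) (True, g x)) \<and> snd (fold h (f x) (True, g x)) = [] \<longleftrightarrow> f x = g x" for x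
    unfolding fold fst_conv snd_conv
  proof
    assume "(True \<and> length (f x) \<le> length (g x) \<and> take (length (f x)) (g x) = f x) \<and> drop (length (f x)) (g x) = []"
    then show "f x = g x" using append_take_drop_id[of "length (f x)" "g x"] by (simp only: append_Nil2)
  qed simp
  ultimately show ?thesis by simp
qed

lemma ptime_word_eq:
  assumes "ptime e (enc_list enc_nat) f" "ptime e (enc_list enc_nat) g"
  shows "ptime e enc_bool (\<lambda>x. f x = g x)"
  by (rule ptime_list_eq[OF assms]) (intro ptime_nat_eq ptime_fst ptime_snd; rule ptime_id)

section \<open>Solutions as words\<close>

definition dbl :: "'a list \<Rightarrow> 'a list" where
  "dbl w = foldr (\<lambda>a v. a # a # v) w []"

lemma dbl_simps [simp]: "dbl [] = []" "dbl (a # w) = a # a # dbl w"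
  by (auto simp: dbl_def)

lemma dbl_eq_Nil [simp]: "dbl w = [] \<longleftrightarrow> w = []"
  by (cases w) auto

lemma dbl_append [simp]: "dbl (u @ v) = dbl u @ dbl v"
  by (induction u) auto

lemma set_dbl [simp]: "set (dbl w) = set w"
  by (induction w) auto

lemma length_dbl [simp]: "length (dbl w) = 2 * length w"
  by (induction w) auto

lemma filter_dbl: "filter P (dbl w) = dbl (filter P w)"
  by (induction w) auto

lemma count_list_dbl: "count_list (dbl w) a = 2 * count_list w a"
  by (induction w) auto

lemma subseq_remdups: "subseq (remdups w) w"
  by (induction w) auto

lemma subseq_set: "subseq u v \<Longrightarrow> set u \<subseteq> set v"
  by (metis notin_set_nthsI subseq_conv_nths subsetI)

lemma count_list_distinct: "distinct w \<Longrightarrow> count_list w a = (if a \<in> set w then 1 else 0)"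
  by (induction w) auto

lemma subseq_dbl: "subseq u w \<Longrightarrow> subseq (dbl u) (dbl w)"
  by (induction rule: list_emb.induct) auto

text \<open>\<open>run\<close> recognizes the prefixes of doubled words. The state is the letter that waits for its
  second copy; the outer \<open>None\<close> is failure.\<close>

fun run :: "'a option \<Rightarrow> 'a list \<Rightarrow> 'a option option" where
  "run s [] = Some s"
| "run None (a # v) = run (Some a) v"
| "run (Some b) (a # v) = (if a = b then run None v else None)"

lemma run_append: "run s (u @ v) = (case run s u of None \<Rightarrow> None | Some s' \<Rightarrow> run s' v)"
  by (induction s u rule: run.induct) auto

lemma run_dbl [simp]: "run None (dbl w) = Some None"
  by (induction w) auto

definition forget :: "'a set \<Rightarrow> 'a option \<Rightarrow> 'a option" where
  "forget D s = (case s of None \<Rightarrow> None | Some a \<Rightarrow> if a \<in> D then None else Some a)"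

lemma run_filter: "run s v = Some s' \<Longrightarrow> run (forget D s) (filter (\<lambda>a. a \<notin> D) v) = Some (forget D s')"
  by (induction s v rule: run.induct) (auto simp: forget_def split: if_splits)

lemma run_None_shape:
  "run None v = Some s' \<Longrightarrow> \<exists>u. v = dbl u @ (case s' of None \<Rightarrow> [] | Some a \<Rightarrow> [a])"
proof (induction "length v" arbitrary: v rule: less_induct)
  case less
  show ?case
  proof (cases v)
    case Nil
    with less.prems show ?thesis by (auto intro: exI[of _ "[]"])
  next
    case v: (Cons a v')
    show ?thesis
    proof (cases v')
      case Nil
      with less.prems v show ?thesis by (auto intro: exI[of _ "[]"])
    next
      case (Cons b v'')
      with less.prems v have "b = a" "run None v'' = Some s'" by (auto split: if_splits)
      with less.hyps[of v''] v Cons obtain u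
        where "v'' = dbl u @ (case s' of None \<Rightarrow> [] | Some a \<Rightarrow> [a])" by auto
      with v Cons \<open>b = a\<close> show ?thesis by (intro exI[of _ "a # u"]) auto
    qed
  qed
qed

lemma run_None_dbl: "run None v = Some None \<Longrightarrow> \<exists>u. v = dbl u"
  using run_None_shape by fastforce

lemma run_shape:
  assumes "run s v = Some s'"
  shows "\<exists>x u y. v = x @ dbl u @ y \<and> length x \<le> 1 \<and> length y \<le> 1"
proof (cases s)
  case None
  with assms obtain u where "v = dbl u @ (case s' of None \<Rightarrow> [] | Some a \<Rightarrow> [a])"
    using run_None_shape by blast
  then show ?thesis by (intro exI[of _ "[]"] exI[of _ u]
        exI[of _ "case s' of None \<Rightarrow> [] | Some a \<Rightarrow> [a]"]) (auto split: option.splits)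
next
  case (Some b)
  show ?thesis
  proof (cases v)
    case (Cons a v')
    with Some assms have "run None v' = Some s'" by (auto split: if_splits)
    then obtain u where "v' = dbl u @ (case s' of None \<Rightarrow> [] | Some a \<Rightarrow> [a])"
      using run_None_shape by blast
    with Cons show ?thesis by (intro exI[of _ "[a]"] exI[of _ u]
        exI[of _ "case s' of None \<Rightarrow> [] | Some a \<Rightarrow> [a]"]) (auto split: option.splits)
  next
    case Nil
    then show ?thesis by (intro exI[of _ "[]"]) auto
  qed
qed

text \<open>Every solution amounts to a word \<open>w\<close> such that \<open>dbl w\<close> is a subsequence; repeated letters
  of \<open>w\<close> only count once.\<close>

definition optimum :: "'a list \<Rightarrow> nat" where
  "optimum L = Max {card (set w) | w. subseq (dbl w) L}"

lemma optimum_set: "finite {card (set w) | w. subseq (dbl w) L}" "{card (set w) | w. subseq (dbl w) L} \<noteq> {}"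
proof -
  have "set w \<subseteq> set L" if "subseq (dbl w) L" for w
    using subseq_set[OF that] by simp
  then have "{card (set w) | w. subseq (dbl w) L} \<subseteq> {..card (set L)}"
    by (auto intro: card_mono)
  then show "finite {card (set w) | w. subseq (dbl w) L}" using finite_subset by blast
  show "{card (set w) | w. subseq (dbl w) L} \<noteq> {}" by (auto intro: exI[of _ "[]"])
qed

lemma optimum_ge: "subseq (dbl w) L \<Longrightarrow> card (set w) \<le> optimum L"
  unfolding optimum_def using optimum_set[of L] by (intro Max_ge) auto

lemma optimum_witness: "\<exists>w. distinct w \<and> subseq (dbl w) L \<and> length w = optimum L"
proof -
  have "optimum L \<in> {card (set w) | w. subseq (dbl w) L}"
    unfolding optimum_def using optimum_set[of L] by (rule Max_in)
  then obtain w where w: "subseq (dbl w) L" "optimum L = card (set w)" by auto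
  have "subseq (dbl (remdups w)) L"
    using subseq_order.trans[OF subseq_dbl[OF subseq_remdups] w(1)] .
  then show ?thesis
    using w(2) by (intro exI[of _ "remdups w"]) (auto simp: length_remdups_card_conv)
qed

lemma optimum_mono: "subseq L' L \<Longrightarrow> optimum L' \<le> optimum L"
  by (metis distinct_card optimum_ge optimum_witness subseq_order.trans)

lemma factors_word:
  assumes "finite S" "disjoint_factors L S"
  shows "\<exists>w. distinct w \<and> subseq (dbl w) L \<and> length w = card S \<and> set w = (\<lambda>f. L ! fst f) ` S"
  using assms
proof (induction S arbitrary: L rule: finite_ranking_induct[where f = snd])
  case empty
  show ?case by (intro exI[of _ "[]"]) auto
next
  case (insert x S)
  show ?case
  proof (cases "x \<in> S")
    case True
    with insert show ?thesis by (simp add: insert_absorb)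
  next
    case False
    let ?a = "L ! fst x"
    let ?M = "take (fst x) L"
    have x: "fst x < snd x" "snd x < length L" "?a = L ! snd x"
      using insert.prems by (auto simp: disjoint_factors_def is_factor_def)
    have before: "snd y < fst x \<and> ?a \<noteq> L ! fst y \<and> is_factor L y" if "y \<in> S" for y
    proof -
      have "x \<noteq> y" using that False by auto
      with that insert.prems have *: "is_factor L y" "{fst x..snd x} \<inter> {fst y..snd y} = {}" "?a \<noteq> L ! fst y"
        by (auto simp: disjoint_factors_def)
      moreover have "snd y \<in> {fst y..snd y}" using *(1) by (auto simp: is_factor_def)
      ultimately have "snd y \<notin> {fst x..snd x}" by blast
      with * insert.hyps(2)[OF that] show ?thesis by auto
    qed
    have letter: "?M ! fst y = L ! fst y" "?M ! snd y = L ! snd y" if "y \<in> S" for y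
      using before[OF that] by (auto simp: is_factor_def)
    have "disjoint_factors ?M S"
      unfolding disjoint_factors_def
    proof (intro conjI ballI impI)
      fix y assume "y \<in> S"
      with before[of y] letter[of y] x show "is_factor ?M y" by (auto simp: is_factor_def)
    next
      fix f g assume "f \<in> S" "g \<in> S" "f \<noteq> g"
      with letter insert.prems show "{fst f..snd f} \<inter> {fst g..snd g} = {}" "?M ! fst f \<noteq> ?M ! fst g"
        by (auto simp: disjoint_factors_def)
    qed
    from insert.IH[OF this] obtain w where w: "distinct w" "subseq (dbl w) ?M" "length w = card S"
      "set w = (\<lambda>f. ?M ! fst f) ` S" by blast
    then have sw: "set w = (\<lambda>f. L ! fst f) ` S" using letter by auto
    have "drop (Suc (fst x)) L ! (snd x - Suc (fst x)) = ?a" using x by simp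
    then have "?a \<in> set (drop (Suc (fst x)) L)" using x by (metis Suc_leI diff_less_mono length_drop nth_mem)
    then have "subseq [?a, ?a] (drop (fst x) L)"
      using x by (subst Cons_nth_drop_Suc[symmetric]) (auto simp: subseq_singleton_left)
    with w(2) have "subseq (dbl (w @ [?a])) (?M @ drop (fst x) L)"
      unfolding dbl_append dbl_simps by (rule list_emb_append_mono)
    moreover have "distinct (w @ [?a])" using w(1) sw before by auto
    ultimately show ?thesis
      using sw w(3) False insert.hyps(1) by (intro exI[of _ "w @ [?a]"]) auto
  qed
qed

lemma subseq_pair:
  assumes "subseq [a, a] L"
  shows "\<exists>p q. p < q \<and> q < length L \<and> L ! p = a \<and> L ! q = a"
proof -
  from list_emb_ConsD[OF assms] obtain us vs where L: "L = us @ a # vs" "subseq [a] vs" by auto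
  then obtain i where "i < length vs" "vs ! i = a" by (auto simp: subseq_singleton_left in_set_conv_nth)
  with L show ?thesis
    by (intro exI[of _ "length us"] exI[of _ "length us + Suc i"]) (auto simp: nth_append)
qed

lemma word_factors:
  assumes "distinct w" "subseq (dbl w) L"
  shows "\<exists>S. finite S \<and> disjoint_factors L S \<and> card S = length w \<and> (\<lambda>f. L ! fst f) ` S = set w"
  using assms
proof (induction w arbitrary: L rule: rev_induct)
  case Nil
  show ?case by (intro exI[of _ "{}"]) (auto simp: disjoint_factors_def)
next
  case (snoc a w)
  then obtain L1 L2 where L: "L = L1 @ L2" "subseq (dbl w) L1" "subseq [a, a] L2"
    using list_emb_appendD[of "(=)" "dbl w" "[a, a]" L] by auto
  obtain S where S: "finite S" "disjoint_factors L1 S" "card S = length w" "(\<lambda>f. L1 ! fst f) ` S = set w"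
    using snoc.IH[OF _ L(2)] snoc.prems(1) by auto
  obtain p q where pq: "p < q" "q < length L2" "L2 ! p = a" "L2 ! q = a"
    using subseq_pair[OF L(3)] by blast
  let ?x = "(length L1 + p, length L1 + q)"
  have inL1: "fst f < snd f \<and> snd f < length L1 \<and> L ! fst f = L1 ! fst f \<and> L ! snd f = L1 ! snd f \<and>
      L1 ! fst f = L1 ! snd f" if "f \<in> S" for f
    using S(2) that L(1) by (auto simp: disjoint_factors_def is_factor_def nth_append)
  have x: "is_factor L ?x" "L ! fst ?x = a" using L(1) pq by (auto simp: is_factor_def nth_append)
  have letters: "(\<lambda>f. L ! fst f) ` S = set w" using S(4) inL1 by auto
  have "?x \<notin> S" using inL1 by fastforce
  have "a \<notin> set w" using snoc.prems(1) by simp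
  have "disjoint_factors L (insert ?x S)"
    unfolding disjoint_factors_def
  proof (intro conjI ballI impI)
    fix f assume "f \<in> insert ?x S"
    then show "is_factor L f" using x(1) inL1[of f] L(1) by (auto simp: is_factor_def)
  next
    fix f g assume fg: "f \<in> insert ?x S" "g \<in> insert ?x S" "f \<noteq> g"
    have S_x: "{fst f..snd f} \<inter> {fst ?x..snd ?x} = {}" "L ! fst f \<noteq> L ! fst ?x" if "f \<in> S" for f
    proof -
      have "L ! fst f \<in> set w" using letters that by blast
      with \<open>a \<notin> set w\<close> show "L ! fst f \<noteq> L ! fst ?x" unfolding x(2) by blast
      show "{fst f..snd f} \<inter> {fst ?x..snd ?x} = {}" using inL1[OF that] by auto
    qed
    have S_S: "{fst f..snd f} \<inter> {fst g..snd g} = {}" "L ! fst f \<noteq> L ! fst g"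
      if "f \<in> S" "g \<in> S" "f \<noteq> g" for f g
      using that S(2) inL1 by (auto simp: disjoint_factors_def)
    from fg consider "f \<in> S" "g \<in> S" | "f = ?x" "g \<in> S" | "f \<in> S" "g = ?x" by blast
    then have "{fst f..snd f} \<inter> {fst g..snd g} = {} \<and> L ! fst f \<noteq> L ! fst g"
    proof cases
      case 1
      with S_S fg(3) show ?thesis by blast
    next
      case 2
      with S_x[of g] show ?thesis by (metis Int_commute)
    next
      case 3
      with S_x[of f] show ?thesis by blast
    qed
    then show "{fst f..snd f} \<inter> {fst g..snd g} = {}" "L ! fst f \<noteq> L ! fst g" by blast+
  qed
  moreover have "(\<lambda>f. L ! fst f) ` insert ?x S = set (w @ [a])"
    unfolding image_insert letters x(2) by simp
  ultimately show ?case
    using S(1,3) \<open>?x \<notin> S\<close> by (intro exI[of _ "insert ?x S"]) auto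
qed

lemma OPT_Disjoint_Factors: "OPT Disjoint_Factors L k = ereal (real (optimum L))"
proof (rule antisym)
  show "OPT Disjoint_Factors L k \<le> ereal (real (optimum L))"
    unfolding OPT_def
  proof (rule SUP_least)
    fix s :: "(nat \<times> nat) list"
    have "card (set s) \<le> optimum L" if "disjoint_factors L (set s)"
      using factors_word[OF _ that] optimum_ge[of _ L] by (metis List.finite_set distinct_card)
    then show "valu Disjoint_Factors L k s \<le> ereal (real (optimum L))"
      by (auto simp: Disjoint_Factors_def DF_def)
  qed
next
  obtain w where w: "distinct w" "subseq (dbl w) L" "length w = optimum L"
    using optimum_witness by blast
  then obtain S where S: "finite S" "disjoint_factors L S" "card S = optimum L"
    using word_factors by metis
  then obtain s where "set s = S" using finite_list by blast
  with S have "valu Disjoint_Factors L k s = ereal (real (optimum L))"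
    by (simp add: Disjoint_Factors_def DF_def)
  then show "ereal (real (optimum L)) \<le> OPT Disjoint_Factors L k"
    unfolding OPT_def by (metis SUP_upper UNIV_I)
qed

fun positions :: "nat \<Rightarrow> 'a list \<Rightarrow> 'a list \<Rightarrow> nat list" where
  "positions i xs [] = []"
| "positions i [] (y # ys) = []"
| "positions i (x # xs) (y # ys) =
    (if y = x then i # positions (Suc i) xs ys else positions (Suc i) (x # xs) ys)"

lemma positions:
  assumes "subseq xs ys"
  shows "length (positions i xs ys) = length xs \<and> sorted_wrt (<) (positions i xs ys) \<and>
    (\<forall>p\<in>set (positions i xs ys). i \<le> p) \<and>
    (\<forall>j<length xs. positions i xs ys ! j < i + length ys \<and> (replicate i undefined @ ys) ! (positions i xs ys ! j) = xs ! j)"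
  using assms
proof (induction i xs ys rule: positions.induct)
  case (1 i xs)
  then show ?case by (auto dest: list_emb_Nil2)
next
  case (3 i x xs y ys)
  have rep: "(replicate i undefined @ y # ys) ! p = (replicate (Suc i) undefined @ ys) ! p" if "Suc i \<le> p" for p
  proof -
    from that obtain d where "p = Suc i + d" using le_Suc_ex by blast
    then show ?thesis by (simp add: nth_append)
  qed
  show ?case
  proof (cases "y = x")
    case True
    let ?P = "positions (Suc i) xs ys"
    have IH: "length ?P = length xs" "sorted_wrt (<) ?P" "\<forall>p\<in>set ?P. Suc i \<le> p"
      "\<And>j. j < length xs \<Longrightarrow> ?P ! j < Suc i + length ys \<and> (replicate (Suc i) undefined @ ys) ! (?P ! j) = xs ! j"
      using 3 True by simp_all
    have nth: "(i # ?P) ! j < i + length (y # ys) \<and> (replicate i undefined @ y # ys) ! ((i # ?P) ! j) = (x # xs) ! j"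
      if "j < length (x # xs)" for j
    proof (cases j)
      case 0
      with True show ?thesis by (simp add: nth_append)
    next
      case (Suc j')
      with that have j': "j' < length xs" by simp
      with IH(1,3) have "Suc i \<le> ?P ! j'" by (metis nth_mem)
      from IH(4)[OF j'] rep[OF this] show ?thesis by (simp only: Suc nth_Cons_Suc list.size) simp
    qed
    from IH nth True show ?thesis by (auto simp: Suc_le_eq less_imp_le)
  next
    case False
    let ?P = "positions (Suc i) (x # xs) ys"
    have IH: "length ?P = length (x # xs)" "sorted_wrt (<) ?P" "\<forall>p\<in>set ?P. Suc i \<le> p"
      "\<And>j. j < length (x # xs) \<Longrightarrow> ?P ! j < Suc i + length ys \<and> (replicate (Suc i) undefined @ ys) ! (?P ! j) = (x # xs) ! j"
      using 3 False by simp_all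
    have nth: "?P ! j < i + length (y # ys) \<and> (replicate i undefined @ y # ys) ! (?P ! j) = (x # xs) ! j"
      if "j < length (x # xs)" for j
    proof -
      from IH(1,3) that have "Suc i \<le> ?P ! j" by (metis nth_mem)
      from IH(4)[OF that] rep[OF this] show ?thesis by simp
    qed
    have "positions i (x # xs) (y # ys) = ?P" using False by simp
    with IH nth show ?thesis by (auto simp: Suc_le_eq less_imp_le)
  qed
qed simp

definition nth0 :: "nat list \<Rightarrow> nat \<Rightarrow> nat" where
  "nth0 xs n = (case drop n xs of [] \<Rightarrow> 0 | x # _ \<Rightarrow> x)"

lemma nth0: "n < length xs \<Longrightarrow> nth0 xs n = xs ! n"
  by (simp add: nth0_def flip: Cons_nth_drop_Suc)

definition lift_solution ::
  "(nat list \<times> nat) \<times> (nat list \<times> nat) \<times> (nat \<times> nat) list \<Rightarrow> (nat \<times> nat) list" where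
  "lift_solution z = (let P = positions 0 (fst (fst (snd z))) (fst (fst z)) in
     map (\<lambda>f. (nth0 P (fst f), nth0 P (snd f))) (snd (snd z)))"

lemma lift_solution:
  assumes "subseq L' L" "disjoint_factors L' (set s)"
  shows "disjoint_factors L (set (lift_solution ((L, k), (L', k'), s)))"
    "card (set (lift_solution ((L, k), (L', k'), s))) = card (set s)"
proof -
  define P where "P = positions 0 L' L"
  have P: "length P = length L'" "sorted_wrt (<) P" "\<And>j. j < length L' \<Longrightarrow> P ! j < length L \<and> L ! (P ! j) = L' ! j"
    using positions[OF assms(1), of 0] by (auto simp: P_def)
  have mono: "P ! i < P ! j" if "i < j" "j < length L'" for i j
    using P(1,2) that by (simp add: sorted_wrt_iff_nth_less)
  define \<phi> where "\<phi> f = (P ! fst f, P ! snd f)" for f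
  have fac: "fst f < snd f" "snd f < length L'" "L' ! fst f = L' ! snd f" if "f \<in> set s" for f
    using assms(2) that by (auto simp: disjoint_factors_def is_factor_def)
  have set: "set (lift_solution ((L, k), (L', k'), s)) = \<phi> ` set s"
  proof -
    have "(nth0 P (fst f), nth0 P (snd f)) = \<phi> f" if "f \<in> set s" for f
      using fac[OF that] P(1) by (simp add: \<phi>_def nth0)
    then show ?thesis unfolding lift_solution_def Let_def by (simp add: P_def)
  qed
  have sep: "{fst (\<phi> f)..snd (\<phi> f)} \<inter> {fst (\<phi> g)..snd (\<phi> g)} = {} \<and> L ! fst (\<phi> f) \<noteq> L ! fst (\<phi> g)"
    if "f \<in> set s" "g \<in> set s" "f \<noteq> g" for f g
  proof -
    have d: "{fst f..snd f} \<inter> {fst g..snd g} = {}" "L' ! fst f \<noteq> L' ! fst g"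
      using that assms(2) by (auto simp: disjoint_factors_def)
    have "snd f < fst g \<or> snd g < fst f"
    proof (rule ccontr)
      assume "\<not> ?thesis"
      then have "max (fst f) (fst g) \<in> {fst f..snd f} \<inter> {fst g..snd g}"
        using fac[OF that(1)] fac[OF that(2)] by auto
      with d(1) show False by blast
    qed
    then have "snd (\<phi> f) < fst (\<phi> g) \<or> snd (\<phi> g) < fst (\<phi> f)"
      using mono fac[OF that(1)] fac[OF that(2)] by (auto simp: \<phi>_def)
    moreover have "L ! fst (\<phi> f) = L' ! fst f" "L ! fst (\<phi> g) = L' ! fst g"
      using P(3) fac[OF that(1)] fac[OF that(2)] by (auto simp: \<phi>_def)
    ultimately show ?thesis using d(2) by auto
  qed
  have "is_factor L (\<phi> f)" if "f \<in> set s" for f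
    using mono[OF fac(1,2)[OF that]] P(3) fac[OF that] by (auto simp: \<phi>_def is_factor_def)
  with sep show "disjoint_factors L (set (lift_solution ((L, k), (L', k'), s)))"
    unfolding set disjoint_factors_def by auto
  have "inj_on \<phi> (set s)"
    using sep by (intro inj_onI) metis
  then show "card (set (lift_solution ((L, k), (L', k'), s))) = card (set s)"
    unfolding set by (rule card_image)
qed

lemma ratio_lift:
  assumes sub: "subseq L' L" and opt: "real (optimum L) \<le> \<alpha> * real (optimum L')" and "1 < \<alpha>"
  shows "ratio Disjoint_Factors L' k' s \<le>
    ereal \<alpha> * ratio Disjoint_Factors L k (lift_solution ((L, k), (L', k'), s))"
proof (cases "disjoint_factors L' (set s)")
  case True
  let ?s = "lift_solution ((L, k), (L', k'), s)"
  define v where "v = card (set s)"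
  have val: "valu Disjoint_Factors L' k' s = ereal (real v)" "valu Disjoint_Factors L k ?s = ereal (real v)"
    using True lift_solution[OF sub True] by (auto simp: Disjoint_Factors_def DF_def v_def)
  have "valu Disjoint_Factors L' k' s \<le> OPT Disjoint_Factors L' k'"
    unfolding OPT_def by (rule SUP_upper) simp
  then have v: "v \<le> optimum L'" unfolding val OPT_Disjoint_Factors by simp
  have mono: "optimum L' \<le> optimum L" by (rule optimum_mono[OF sub])
  show ?thesis
  proof (cases "v = optimum L")
    case True
    with v mono \<open>1 < \<alpha>\<close> show ?thesis by (simp add: ratio_def val OPT_Disjoint_Factors one_ereal_def)
  next
    case False
    with v mono have pos: "0 < optimum L" by simp
    then have pos': "0 < optimum L'" using opt \<open>1 < \<alpha>\<close> by (cases "optimum L' = 0") auto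
    have "real v / real (optimum L') \<le> \<alpha> * (real v / real (optimum L))"
      using opt pos pos' mult_left_mono[OF opt, of "real v"] by (simp add: field_simps)
    with False pos pos' show ?thesis
      by (auto simp: ratio_def val OPT_Disjoint_Factors one_ereal_def)
  qed
next
  case False
  then have "valu Disjoint_Factors L' k' s = - \<infinity>" by (simp add: Disjoint_Factors_def DF_def)
  then have "ratio Disjoint_Factors L' k' s = - \<infinity>"
    by (auto simp: ratio_def OPT_Disjoint_Factors divide_ereal_def)
  then show ?thesis by simp
qed

section \<open>Rearranging a solution along a block decomposition\<close>

lemma greedy_cover:
  fixes X :: "'i \<Rightarrow> 'a set"
  assumes "finite S" "\<And>i. finite (X i)"
  obtains G where "G \<subseteq> S" "q * card G \<le> card (\<Union>(X ` G))"
    "\<And>i. i \<in> S \<Longrightarrow> card (X i - \<Union>(X ` G)) \<le> q"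
proof -
  define P where "P G \<longleftrightarrow> G \<subseteq> S \<and> q * card G \<le> card (\<Union>(X ` G))" for G
  have "P {}" by (simp add: P_def)
  moreover have "\<forall>G. P G \<longrightarrow> card G < Suc (card S)"
    using assms(1) by (auto simp: P_def less_Suc_eq_le intro: card_mono)
  ultimately obtain G where G: "P G" "\<And>H. P H \<Longrightarrow> card H \<le> card G"
    using ex_has_greatest_nat[of P "{}" card] by blast
  have fin: "finite G" "finite (\<Union>(X ` G))" using G(1) assms finite_subset unfolding P_def by auto
  have "card (X i - \<Union>(X ` G)) \<le> q" if i: "i \<in> S" for i
  proof (rule ccontr)
    assume *: "\<not> ?thesis"
    have "i \<notin> G"
    proof
      assume "i \<in> G"
      then have "X i - \<Union>(X ` G) = {}" by blast
      with * show False by simp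
    qed
    have "card (\<Union>(X ` insert i G)) = card (\<Union>(X ` G)) + card (X i - \<Union>(X ` G))"
      using fin assms by (subst card_Un_disjoint[symmetric]) (auto intro: arg_cong[where f = card])
    then have "P (insert i G)"
      using G(1) * i \<open>i \<notin> G\<close> fin by (auto simp: P_def)
    from G(2)[OF this] \<open>i \<notin> G\<close> fin show False by simp
  qed
  with G(1) show ?thesis by (intro that[of G]) (auto simp: P_def)
qed

lemma subseq_concat_split:
  "subseq v (concat (map B [0..<n])) \<Longrightarrow>
    \<exists>u. v = concat (map u [0..<n]) \<and> (\<forall>j<n. subseq (u j) (B j))"
proof (induction n arbitrary: v)
  case (Suc n)
  then obtain x y where xy: "v = x @ y" "subseq x (concat (map B [0..<n]))" "subseq y (B n)"
    by (auto simp: subseq_append_iff)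
  then obtain u where u: "x = concat (map u [0..<n])" "\<forall>j<n. subseq (u j) (B j)"
    using Suc.IH by blast
  define u' where "u' = u(n := y)"
  have *: "map u' [0..<n] = map u [0..<n]" "u' n = y" by (auto simp: u'_def)
  have "v = concat (map u' [0..<Suc n])" using xy(1) u(1) by (simp add: *)
  moreover have "subseq (u' j) (B j)" if "j < Suc n" for j
    using that u(2) xy(3) by (auto simp: u'_def less_Suc_eq)
  ultimately show ?case by blast
qed auto

lemma subseq_concat_mono:
  "(\<And>j. j < n \<Longrightarrow> subseq (u j) (B j)) \<Longrightarrow> subseq (concat (map u [0..<n])) (concat (map B [0..<n]))"
  by (induction n) (auto intro: list_emb_append_mono)

lemma run_concat:
  assumes "\<And>j. j < n \<Longrightarrow> run (s j) (v j) = Some (s (Suc j))"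
  shows "run (s 0) (concat (map v [0..<n])) = Some (s n)"
  using assms by (induction n) (auto simp: run_append)

lemma run_concat_states:
  assumes "run None (concat (map v [0..<n])) = Some None"
  shows "\<exists>s. s 0 = None \<and> s n = None \<and> (\<forall>j<n. run (s j) (v j) = Some (s (Suc j)))"
proof -
  define s where "s j = the (run None (concat (map v [0..<j])))" for j
  have *: "run None (concat (map v [0..<j])) \<noteq> None" if "j \<le> n" for j
  proof
    assume "run None (concat (map v [0..<j])) = None"
    then have "run None (concat (map v [0..<j]) @ concat (map v [j..<n])) = None"
      by (simp add: run_append)
    also have "concat (map v [0..<j]) @ concat (map v [j..<n]) = concat (map v [0..<n])"
      using that upt_add_eq_append[of 0 j "n - j"] by (simp flip: concat_append map_append)
    finally show False using assms by simp
  qed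
  have "run (s j) (v j) = Some (s (Suc j))" if "j < n" for j
    using *[of j] *[of "Suc j"] that by (auto simp: s_def run_append split: option.splits)
  then show ?thesis using assms by (intro exI[of _ s]) (auto simp: s_def)
qed

lemma card_nonempty_le:
  "card {j. j < n \<and> v j \<noteq> []} \<le> length (concat (map v [0..<n]))"
proof (induction n)
  case (Suc n)
  have "{j. j < Suc n \<and> v j \<noteq> []} = {j. j < n \<and> v j \<noteq> []} \<union> (if v n \<noteq> [] then {n} else {})"
    by (auto simp: less_Suc_eq)
  then have "card {j. j < Suc n \<and> v j \<noteq> []} \<le> card {j. j < n \<and> v j \<noteq> []} + length (v n)"
    by (cases "v n") auto
  with Suc show ?case by simp
qed auto

lemma distinct_piece:
  assumes "distinct w" "dbl w = concat (map v [0..<n])" "j < n" "v j = x @ dbl u @ y"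
  shows "distinct u"
proof -
  have "[0..<n] = [0..<j] @ j # [Suc j..<n]"
    using assms(3) upt_add_eq_append[of 0 j "n - j"] by (simp add: upt_conv_Cons)
  then have "count_list (dbl u) a \<le> count_list (dbl w) a" for a
    using assms(2,4) by simp
  moreover have "count_list w a \<le> 1" for a
    using assms(1) by (simp add: count_list_distinct)
  ultimately have "count_list u a \<le> 1" for a
    unfolding count_list_dbl by (meson le_trans mult_le_cancel1 zero_less_numeral)
  then show ?thesis
  proof (induction u)
    case (Cons b u)
    have "count_list u a \<le> 1" for a using Cons.prems[of a] by (auto split: if_splits)
    moreover have "b \<notin> set u" using Cons.prems[of b] by (auto simp: count_list_0_iff)
    ultimately show ?case using Cons.IH by auto
  qed auto
qed

lemma set_concat_upt: "set (concat (map v [0..<n])) = (\<Union>j<n. set (v j))"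
  by auto

lemma exchange:
  fixes B C T :: "nat \<Rightarrow> 'a list" and A :: "nat \<Rightarrow> 'a set"
  assumes T: "\<And>j. j < n \<Longrightarrow> T j \<noteq> [] \<Longrightarrow> subseq (dbl (T j)) (C j) \<and> distinct (T j) \<and> length (T j) = t"
    and N: "\<And>a. card {j. j < n \<and> a \<in> set (T j)} \<le> 4 * k"
    and A: "\<And>j a. j < n \<Longrightarrow> a \<notin> A j \<Longrightarrow> 4 * k \<le> card {j. j < n \<and> a \<in> set (T j)}"
    and C: "\<And>j v. j < n \<Longrightarrow> set v \<subseteq> A j \<Longrightarrow> length v \<le> 2 * t + 2 \<Longrightarrow> subseq v (B j) \<Longrightarrow> subseq v (C j)"
    and small: "\<And>j u. j < n \<Longrightarrow> set u \<subseteq> A j \<Longrightarrow> distinct u \<Longrightarrow> subseq (dbl u) (B j) \<Longrightarrow> length u \<le> t"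
    and w: "distinct w" "subseq (dbl w) (concat (map B [0..<n]))" "length w \<le> k"
    and U: "card (\<Union>j<n. set (T j)) \<le> length w"
    and q: "t = 2 * q * q" "0 < q"
  shows "\<exists>w'. subseq (dbl w') (concat (map C [0..<n])) \<and>
    q * length w \<le> q * card (set w') + 2 * length w"
proof -
  obtain v where v: "dbl w = concat (map v [0..<n])" "\<And>j. j < n \<Longrightarrow> subseq (v j) (B j)"
    using subseq_concat_split[OF w(2)] by auto
  have "run None (concat (map v [0..<n])) = Some None" by (metis run_dbl v(1))
  from run_concat_states[OF this] obtain s where
    s: "s 0 = None" "s n = None" "\<And>j. j < n \<Longrightarrow> run (s j) (v j) = Some (s (Suc j))"
    by auto
  define K where "K = (\<Union>j<n. set (v j) - A j)"
  define v1 where "v1 j = filter (\<lambda>a. a \<notin> K) (v j)" for j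
  define s1 where "s1 j = forget K (s j)" for j
  have s1: "s1 0 = None" "s1 n = None" "\<And>j. j < n \<Longrightarrow> run (s1 j) (v1 j) = Some (s1 (Suc j))"
    unfolding s1_def v1_def using s(1,2) by (auto simp: forget_def intro: run_filter[unfolded forget_def] s(3))
  have set_v: "(\<Union>j<n. set (v j)) = set w"
    using arg_cong[OF v(1), of set] unfolding set_concat_upt by simp
  then have K: "K \<subseteq> set w" "finite K" by (auto simp: K_def)
  have v1: "subseq (v1 j) (C j)" if j: "j < n" for j
  proof -
    obtain x u y where xuy: "v j = x @ dbl u @ y" "length x \<le> 1" "length y \<le> 1"
      using run_shape[OF s(3)[OF j]] by blast
    let ?f = "filter (\<lambda>a. a \<notin> K)"
    have alive: "set (v1 j) \<subseteq> A j" using j by (auto simp: v1_def K_def)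
    have sub: "subseq (v1 j) (B j)"
      using subseq_order.trans[OF subseq_filter_left v(2)[OF j]] unfolding v1_def .
    have v1j: "v1 j = ?f x @ dbl (?f u) @ ?f y" by (simp add: v1_def xuy filter_dbl)
    have "length (?f u) \<le> t"
    proof (rule small[OF j])
      show "distinct (?f u)" using distinct_piece[OF w(1) v(1) _ xuy(1)] j by simp
      have "subseq (dbl (?f u)) (v1 j)" unfolding v1j by (simp add: list_emb_append2 list_emb_prefix)
      with sub show "subseq (dbl (?f u)) (B j)" by (rule subseq_order.trans[rotated])
    qed (use alive v1j in auto)
    moreover have "length (?f x) \<le> 1" "length (?f y) \<le> 1"
      using xuy length_filter_le order.trans by blast+
    ultimately have "length (v1 j) \<le> 2 * t + 2" by (simp add: v1j)
    then show ?thesis using C[OF j _ _ sub] alive by blast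
  qed
  define free where "free = {j. j < n \<and> T j \<noteq> [] \<and> v1 j = []}"
  define X where "X g = K \<inter> (\<Union>j\<in>{j\<in>free. s1 j = g}. set (T j))" for g
  have fin: "finite free" "\<And>g. finite (X g)" using K(2) by (auto simp: free_def X_def)
  obtain G where G: "G \<subseteq> s1 ` free" "q * card G \<le> card (\<Union>(X ` G))"
    "\<And>g. g \<in> s1 ` free \<Longrightarrow> card (X g - \<Union>(X ` G)) \<le> q"
    by (rule greedy_cover[OF finite_imageI[OF fin(1), of s1], of X q, OF fin(2)]) (erule (1) that, blast)
  define D where "D = {a. Some a \<in> G}"
  define J where "J = {j \<in> free. s1 j \<in> G}"
  define v2 where "v2 j = (if j \<in> J then dbl (T j) else filter (\<lambda>a. a \<notin> D) (v1 j))" for j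
  have finG: "finite G" using finite_subset[OF G(1)] fin(1) by blast
  have "run (forget D (s1 j)) (v2 j) = Some (forget D (s1 (Suc j)))" if "j < n" for j
  proof (cases "j \<in> J")
    case True
    then have "v1 j = []" "s1 j \<in> G" by (auto simp: J_def free_def)
    with s1(3)[of j] that have "s1 (Suc j) = s1 j" by simp
    moreover have "forget D (s1 j) = None"
      using \<open>s1 j \<in> G\<close> by (auto simp: forget_def D_def split: option.splits)
    ultimately show ?thesis using True by (simp add: v2_def)
  next
    case False
    then show ?thesis using run_filter s1(3)[of j] that by (auto simp: v2_def)
  qed
  from run_concat[of n "\<lambda>j. forget D (s1 j)" v2, OF this] s1(1,2)
  have "run None (concat (map v2 [0..<n])) = Some None" by (simp add: forget_def)
  then obtain w' where w': "concat (map v2 [0..<n]) = dbl w'" using run_None_dbl by blast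
  have "subseq (v2 j) (C j)" if "j < n" for j
    using T[of j] v1[OF that] subseq_order.trans[OF subseq_filter_left v1[OF that]]
    by (auto simp: v2_def J_def free_def)
  then have 1: "subseq (dbl w') (concat (map C [0..<n]))"
    unfolding w'[symmetric] by (intro subseq_concat_mono) (simp add: less_Suc_eq_le)
  have set_w': "set w' = (\<Union>j<n. set (v2 j))"
    using arg_cong[OF w', of set] unfolding set_concat_upt by simp
  define K' where "K' = K - \<Union>(X ` G)"
  have "set w - K - D \<subseteq> set w'"
  proof
    fix a assume a: "a \<in> set w - K - D"
    then obtain j where j: "j < n" "a \<in> set (v j)" using set_v by blast
    with a have "a \<in> set (v1 j)" by (auto simp: v1_def)
    then have "j \<notin> J" by (auto simp: J_def free_def)
    with a j \<open>a \<in> set (v1 j)\<close> have "a \<in> set (v2 j)" by (auto simp: v2_def)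
    with j show "a \<in> set w'" using set_w' by blast
  qed
  moreover have XK: "\<Union>(X ` G) \<subseteq> K" by (auto simp: X_def)
  moreover have "\<Union>(X ` G) \<subseteq> set w'"
  proof
    fix a assume "a \<in> \<Union>(X ` G)"
    then obtain j where "j \<in> J" "a \<in> set (T j)" by (auto simp: X_def J_def)
    then show "a \<in> set w'" unfolding set_w' by (auto simp: J_def free_def v2_def intro!: bexI[of _ j])
  qed
  ultimately have "card ((set w - K - D) \<union> \<Union>(X ` G)) \<le> card (set w')"
    by (intro card_mono) auto
  moreover have "card ((set w - K - D) \<union> \<Union>(X ` G)) = card (set w - K - D) + card (\<Union>(X ` G))"
    using XK finite_subset[OF XK K(2)] by (intro card_Un_disjoint) auto
  moreover have "finite D" "card D \<le> card G"
    using finG card_image[of Some D] card_mono[of G "Some ` D"] finite_imageD[of Some D] finite_subset[of "Some ` D" G]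
    by (auto simp: D_def image_subset_iff)
  then have "card (set w - K) - card G \<le> card (set w - K - D)"
    using diff_card_le_card_Diff[of D "set w - K"] by linarith
  moreover have "card (set w - K) = length w - card K" "card K \<le> length w"
    using K w(1) card_mono[OF _ K(1)] by (auto simp: card_Diff_subset distinct_card)
  moreover have "card K = card K' + card (\<Union>(X ` G))"
    using XK K(2) finite_subset[OF XK K(2)] card_mono[OF K(2) XK] by (simp add: K'_def card_Diff_subset)
  ultimately have 2: "length w \<le> card (set w') + card G + card K'" "card (\<Union>(X ` G)) \<le> length w"
    by linarith+
  have 3: "q * card G \<le> length w" using G(2) 2(2) by linarith
  have finK': "finite K'" using K(2) by (simp add: K'_def)
  have touched: "card {j. j < n \<and> v1 j \<noteq> []} \<le> 2 * k"
  proof -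
    have "concat (map v1 [0..<n]) = filter (\<lambda>a. a \<notin> K) (dbl w)"
      unfolding v(1) filter_concat by (simp add: v1_def[abs_def] comp_def)
    then show ?thesis
      using card_nonempty_le[of n v1] length_filter_le[of "\<lambda>a. a \<notin> K" "dbl w"] w(3) by simp
  qed
  have K'count: "2 * k \<le> card {j\<in>free. a \<in> set (T j)}" if "a \<in> K'" for a
  proof -
    have "4 * k \<le> card {j. j < n \<and> a \<in> set (T j)}"
      using that A by (auto simp: K'_def K_def)
    also have "\<dots> \<le> card ({j\<in>free. a \<in> set (T j)} \<union> {j. j < n \<and> v1 j \<noteq> []})"
      by (rule card_mono) (auto simp: free_def)
    also have "\<dots> \<le> card {j\<in>free. a \<in> set (T j)} + 2 * k"
      by (rule order.trans[OF card_Un_le]) (use touched in simp)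
    finally show ?thesis by simp
  qed
  define b where "b = card {j. j < n \<and> T j \<noteq> []}"
  with K'count have "card K' * (2 * k) \<le> (\<Sum>a\<in>K'. card {j\<in>free. a \<in> set (T j)})"
    using sum_bounded_below[of K' "2 * k" "\<lambda>a. card {j\<in>free. a \<in> set (T j)}"] by simp
  also have "\<dots> = (\<Sum>j\<in>free. card {a\<in>K'. a \<in> set (T j)})"
    by (rule sum_multicount_gen) (use fin(1) finK' in auto)
  also have "\<dots> \<le> (\<Sum>j\<in>free. q)"
  proof (rule sum_mono)
    fix j assume j: "j \<in> free"
    then have "{a\<in>K'. a \<in> set (T j)} \<subseteq> X (s1 j) - \<Union>(X ` G)" by (auto simp: X_def K'_def)
    then have "card {a\<in>K'. a \<in> set (T j)} \<le> card (X (s1 j) - \<Union>(X ` G))"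
      by (rule card_mono[rotated]) (simp add: X_def K)
    also have "\<dots> \<le> q" using G(3) j by blast
    finally show "card {a\<in>K'. a \<in> set (T j)} \<le> q" .
  qed
  also have "\<dots> \<le> b * q"
    unfolding b_def by (auto intro!: mult_le_mono1 card_mono simp: free_def)
  finally have 4: "card K' * (2 * k) \<le> b * q" .
  have "b * t = (\<Sum>j\<in>{j. j < n \<and> T j \<noteq> []}. t)" by (simp add: b_def)
  also have "\<dots> = (\<Sum>j\<in>{j. j < n \<and> T j \<noteq> []}. card {a \<in> (\<Union>j<n. set (T j)). a \<in> set (T j)})"
  proof (rule sum.cong)
    fix j assume j: "j \<in> {j. j < n \<and> T j \<noteq> []}"
    then have "{a \<in> (\<Union>j<n. set (T j)). a \<in> set (T j)} = set (T j)" by auto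
    with T[of j] j show "t = card {a \<in> (\<Union>j<n. set (T j)). a \<in> set (T j)}"
      by (simp add: distinct_card)
  qed simp
  also have "\<dots> = (\<Sum>a\<in>(\<Union>j<n. set (T j)). card {j\<in>{j. j < n \<and> T j \<noteq> []}. a \<in> set (T j)})"
    by (rule sum_multicount_gen) auto
  also have "\<dots> \<le> (\<Sum>a\<in>(\<Union>j<n. set (T j)). 4 * k)"
  proof (rule sum_mono)
    fix a
    have "{j\<in>{j. j < n \<and> T j \<noteq> []}. a \<in> set (T j)} = {j. j < n \<and> a \<in> set (T j)}" by auto
    with N show "card {j\<in>{j. j < n \<and> T j \<noteq> []}. a \<in> set (T j)} \<le> 4 * k" by simp
  qed
  also have "\<dots> \<le> length w * (4 * k)" using U by (auto intro: mult_le_mono1)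
  finally have 5: "b * t \<le> length w * (4 * k)" .
  have "q * card K' \<le> length w"
  proof (cases "k = 0")
    case True
    with w(3) K(1) show ?thesis by (auto simp: K'_def)
  next
    case False
    have "2 * k * (q * (2 * (q * card K'))) = card K' * (2 * k) * t" by (simp add: q)
    also have "\<dots> \<le> b * q * t" using 4 by (rule mult_le_mono1)
    also have "\<dots> \<le> 2 * k * (q * (2 * length w))" using 5 q(2) by (simp add: ac_simps)
    finally show ?thesis using False q(2) by simp
  qed
  with 3 have "q * card G + q * card K' \<le> 2 * length w" by simp
  moreover have "q * length w \<le> q * card (set w') + (q * card G + q * card K')"
    using mult_le_mono2[OF 2(1), of q] by (simp add: algebra_simps)
  ultimately show ?thesis using 1 by (intro exI[of _ w']) auto
qed

section \<open>The reduction\<close>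

text \<open>
  The scan reads the string from its end, so that all lists grow at the front. In its state
  \<open>(W, H, C)\<close>, \<open>W\<close> consists of the words of length at most \<open>2 * t + 2\<close> that are subsequences of the
  kept part of the current block, \<open>H\<close> is the concatenation of the words of the complete blocks, and
  \<open>C\<close> is the part of the string kept so far. A letter is kept only if it enlarges \<open>W\<close>.
\<close>

definition is_dbl :: "nat \<Rightarrow> 'a list \<Rightarrow> bool" where
  "is_dbl t v \<longleftrightarrow> length v = 2 * t \<and> dbl (remdups v) = v"

definition new_words :: "nat \<Rightarrow> 'a \<Rightarrow> 'a list list \<Rightarrow> 'a list list" where
  "new_words r a W = filter (\<lambda>v. v \<notin> set W) (map (Cons a) (filter (\<lambda>v. length v < r) W))"

definition step :: "nat \<Rightarrow> nat \<Rightarrow> 'a \<Rightarrow> 'a list list \<times> 'a list \<times> 'a list \<Rightarrow> 'a list list \<times> 'a list \<times> 'a list" where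
  "step t k a = (\<lambda>(W, H, C).
     if 4 * k \<le> count_list H a then (W, H, C)
     else case new_words (2 * t + 2) a W of
       [] \<Rightarrow> (W, H, C)
     | _ # _ \<Rightarrow>
        (case filter (is_dbl t) (new_words (2 * t + 2) a W) of
           [] \<Rightarrow> (new_words (2 * t + 2) a W @ W, H, a # C)
         | v # _ \<Rightarrow> ([[]], remdups v @ H, a # C)))"

definition scan :: "nat \<Rightarrow> nat \<Rightarrow> 'a list \<Rightarrow> 'a list list \<times> 'a list \<times> 'a list" where
  "scan t k L = foldr (step t k) L ([[]], [], [])"

definition kernel_word :: "nat \<Rightarrow> nat \<Rightarrow> 'a list \<Rightarrow> 'a list" where
  "kernel_word t k L = snd (snd (scan t k L))"

lemma is_dbl_iff: "is_dbl t v \<longleftrightarrow> (\<exists>u. distinct u \<and> length u = t \<and> v = dbl u)"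
proof
  assume "is_dbl t v"
  then have v: "length v = 2 * t" "dbl (remdups v) = v" by (auto simp: is_dbl_def)
  then have "length v = 2 * length (remdups v)" by (metis length_dbl)
  with v show "\<exists>u. distinct u \<and> length u = t \<and> v = dbl u" by (intro exI[of _ "remdups v"]) auto
next
  have "remdups (dbl u) = u" if "distinct u" for u :: "'a list"
    using that by (induction u) auto
  then show "\<exists>u. distinct u \<and> length u = t \<and> v = dbl u \<Longrightarrow> is_dbl t v" by (auto simp: is_dbl_def)
qed

lemma set_new_words: "set (new_words r a W) = {a # v | v. v \<in> set W \<and> length v < r} - set W"
  by (auto simp: new_words_def)

lemma distinct_new_words: "distinct W \<Longrightarrow> distinct (new_words r a W @ W)"
  by (auto simp: new_words_def distinct_map)

lemma subseq_Cons_right: "subseq v (a # B) \<longleftrightarrow> subseq v B \<or> (\<exists>v'. v = a # v' \<and> subseq v' B)"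
  by (cases v) (auto elim: subseq_Cons')

lemma subseq_Cons_notin: "a \<notin> set v \<Longrightarrow> subseq v (a # B) \<longleftrightarrow> subseq v B"
  by (cases v) auto

lemma scan_step:
  obtains (dead) "4 * k \<le> count_list H a" "step t k a (W, H, C) = (W, H, C)"
  | (old) "count_list H a < 4 * k" "\<And>v. v \<in> set W \<Longrightarrow> length v < 2 * t + 2 \<Longrightarrow> a # v \<in> set W"
      "step t k a (W, H, C) = (W, H, C)"
  | (new) "count_list H a < 4 * k" "new_words (2 * t + 2) a W \<noteq> []"
      "\<And>u. distinct u \<Longrightarrow> length u = t \<Longrightarrow> dbl u \<notin> set (new_words (2 * t + 2) a W)"
      "step t k a (W, H, C) = (new_words (2 * t + 2) a W @ W, H, a # C)"
  | (close) T where "count_list H a < 4 * k" "distinct T" "length T = t"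
      "dbl T \<in> set (new_words (2 * t + 2) a W)"
      "step t k a (W, H, C) = ([[]], T @ H, a # C)"
proof (cases "4 * k \<le> count_list H a")
  case True
  then show ?thesis by (intro dead) (auto simp: step_def)
next
  case alive: False
  show ?thesis
  proof (cases "new_words (2 * t + 2) a W")
    case Nil
    with set_new_words[of "2 * t + 2" a W] have "\<And>v. v \<in> set W \<Longrightarrow> length v < 2 * t + 2 \<Longrightarrow> a # v \<in> set W"
      by auto
    then show ?thesis using alive Nil by (intro old) (auto simp: step_def)
  next
    case (Cons x xs)
    show ?thesis
    proof (cases "filter (is_dbl t) (new_words (2 * t + 2) a W)")
      case Nil
      then have "\<And>v. v \<in> set (new_words (2 * t + 2) a W) \<Longrightarrow> \<not> is_dbl t v" by (simp add: filter_empty_conv)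
      then have "\<And>u. distinct u \<Longrightarrow> length u = t \<Longrightarrow> dbl u \<notin> set (new_words (2 * t + 2) a W)"
        unfolding is_dbl_iff by blast
      with alive Nil Cons show ?thesis by (intro new) (auto simp: step_def)
    next
      case (Cons v vs)
      then have v: "is_dbl t v" "v \<in> set (new_words (2 * t + 2) a W)"
        by (auto simp: filter_eq_Cons_iff)
      then have "distinct (remdups v)" "length (remdups v) = t" "dbl (remdups v) = v"
        using length_dbl[of "remdups v"] by (auto simp: is_dbl_def)
      with v alive Cons \<open>new_words _ _ _ = x # xs\<close> show ?thesis
        by (intro close[of "remdups v"]) (auto simp: step_def)
    qed
  qed
qed

record 'a block =
  source :: "'a list"
  kept :: "'a list"
  word :: "'a list"
  alive :: "'a set"

definition good :: "nat \<Rightarrow> 'a block \<Rightarrow> bool" where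
  "good t \<beta> \<longleftrightarrow> subseq (kept \<beta>) (source \<beta>) \<and>
     (\<forall>v. set v \<subseteq> alive \<beta> \<longrightarrow> length v \<le> 2 * t + 2 \<longrightarrow> subseq v (source \<beta>) \<longrightarrow> subseq v (kept \<beta>)) \<and>
     (\<forall>u. set u \<subseteq> alive \<beta> \<longrightarrow> distinct u \<longrightarrow> subseq (dbl u) (source \<beta>) \<longrightarrow> length u \<le> t)"

definition saturated :: "nat \<Rightarrow> 'a block \<Rightarrow> bool" where
  "saturated t \<beta> \<longleftrightarrow> subseq (dbl (word \<beta>)) (kept \<beta>) \<and> distinct (word \<beta>) \<and> length (word \<beta>) = t"

definition unsaturated :: "nat \<Rightarrow> 'a block \<Rightarrow> bool" where
  "unsaturated t \<beta> \<longleftrightarrow> set (kept \<beta>) \<subseteq> alive \<beta> \<and> word \<beta> = [] \<and>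
     (\<forall>u. set u \<subseteq> alive \<beta> \<longrightarrow> distinct u \<longrightarrow> length u = t \<longrightarrow> \<not> subseq (dbl u) (source \<beta>))"

definition scan_inv :: "nat \<Rightarrow> nat \<Rightarrow> 'a list \<Rightarrow> 'a list list \<Rightarrow> 'a list \<Rightarrow> 'a list \<Rightarrow> 'a block \<Rightarrow> 'a block list \<Rightarrow> bool" where
  "scan_inv t k L W H C \<beta> bs \<longleftrightarrow>
     L = concat (map source (\<beta> # bs)) \<and> C = concat (map kept (\<beta> # bs)) \<and>
     H = concat (map word bs) \<and> (\<forall>a. count_list H a \<le> 4 * k) \<and>
     distinct W \<and> set W = {v. subseq v (kept \<beta>) \<and> length v \<le> 2 * t + 2} \<and>
     good t \<beta> \<and> unsaturated t \<beta> \<and> alive \<beta> = {a. count_list H a < 4 * k} \<and>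
     (\<forall>\<gamma>\<in>set bs. good t \<gamma> \<and> saturated t \<gamma> \<and> - alive \<gamma> \<subseteq> {a. 4 * k \<le> count_list H a})"

lemma scan_invI:
  assumes "L = concat (map source (\<beta> # bs))" "C = concat (map kept (\<beta> # bs))"
    "H = concat (map word bs)" "\<And>a. count_list H a \<le> 4 * k" "distinct W"
    "set W = {v. subseq v (kept \<beta>) \<and> length v \<le> 2 * t + 2}"
    "good t \<beta>" "unsaturated t \<beta>" "alive \<beta> = {a. count_list H a < 4 * k}"
    "\<And>\<gamma>. \<gamma> \<in> set bs \<Longrightarrow> good t \<gamma> \<and> saturated t \<gamma> \<and> - alive \<gamma> \<subseteq> {a. 4 * k \<le> count_list H a}"
  shows "scan_inv t k L W H C \<beta> bs"
  unfolding scan_inv_def using assms by blast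

lemma unsaturated_less:
  assumes "unsaturated t \<beta>" "set u \<subseteq> alive \<beta>" "distinct u" "subseq (dbl u) (source \<beta>)"
  shows "length u < t"
proof (rule ccontr)
  assume "\<not> length u < t"
  then have "length (take t u) = t" by simp
  moreover have "subseq (dbl (take t u)) (source \<beta>)"
    using assms(4) subseq_dbl[of "take t u" u] subseq_order.trans
    by (metis prefix_imp_subseq take_is_prefix)
  ultimately show False
    using assms(1-3) set_take_subset[of t u] unfolding unsaturated_def
    by (meson distinct_take order.trans)
qed

lemma good_skip:
  assumes "good t \<beta>" "a \<notin> alive \<beta>"
  shows "good t (\<beta>\<lparr>source := a # source \<beta>\<rparr>)"
proof -
  have "subseq v (a # source \<beta>) \<longleftrightarrow> subseq v (source \<beta>)" if "set v \<subseteq> alive \<beta>" for v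
    using that assms(2) by (intro subseq_Cons_notin) auto
  with assms(1) show ?thesis by (auto simp: good_def)
qed

lemma length_le_of_subseq_Cons:
  assumes "unsaturated t \<beta>" "set u \<subseteq> alive \<beta>" "distinct u" "subseq (dbl u) (a # source \<beta>)"
  shows "length u \<le> t"
proof (cases u)
  case (Cons b u')
  with assms(4) have "subseq (b # dbl u') (source \<beta>)"
    by (auto split: if_splits dest: subseq_Cons')
  then have "length u' < t"
    using Cons assms by (intro unsaturated_less) (auto dest: subseq_Cons')
  with Cons show ?thesis by simp
qed simp

lemma scan_inv_step:
  assumes inv: "scan_inv t k L W H C \<beta> bs" and "0 < t"
    and st: "step t k a (W, H, C) = (W', H', C')"
  shows "\<exists>\<beta>' bs'. scan_inv t k (a # L) W' H' C' \<beta>' bs'"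
proof -
  note inv' = inv[unfolded scan_inv_def]
  have C: "C = concat (map kept (\<beta> # bs))" and H: "H = concat (map word bs)"
    and cnt: "\<And>a. count_list H a \<le> 4 * k" and distW: "distinct W"
    and bs: "\<And>\<gamma>. \<gamma> \<in> set bs \<Longrightarrow> good t \<gamma> \<and> saturated t \<gamma> \<and> - alive \<gamma> \<subseteq> {a. 4 * k \<le> count_list H a}"
    using inv' by blast+
  have L: "a # L = concat (map source (\<beta>\<lparr>source := a # source \<beta>\<rparr> # bs))" using inv' by simp
  have W: "set W = {v. subseq v (kept \<beta>) \<and> length v \<le> 2 * t + 2}" using inv' by blast
  have \<beta>: "good t \<beta>" "unsaturated t \<beta>" "alive \<beta> = {a. count_list H a < 4 * k}" using inv' by blast+
  have sub: "subseq (kept \<beta>) (source \<beta>)" using \<beta>(1) by (simp add: good_def)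
  have ext: "subseq v (kept \<beta>) \<or> (\<exists>v'. v = a # v' \<and> subseq v' (kept \<beta>))"
    if "set v \<subseteq> alive \<beta>" "length v \<le> 2 * t + 2" "subseq v (a # source \<beta>)" for v
    using that \<beta>(1) unfolding subseq_Cons_right good_def by auto
  show ?thesis
  proof (cases rule: scan_step[of k H a t W C])
    case dead
    let ?\<beta> = "\<beta>\<lparr>source := a # source \<beta>\<rparr>"
    have "good t ?\<beta>" using good_skip[OF \<beta>(1), of a] \<beta>(3) dead(1) by simp
    moreover have "unsaturated t ?\<beta>"
      unfolding unsaturated_def
    proof (intro conjI allI impI)
      fix u assume u: "set u \<subseteq> alive ?\<beta>" "distinct u" "length u = t"
      then have "a \<notin> set (dbl u)" using \<beta>(3) dead by auto
      then have "subseq (dbl u) (source ?\<beta>) \<longleftrightarrow> subseq (dbl u) (source \<beta>)"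
        by (simp add: subseq_Cons_notin)
      with u \<beta>(2) show "\<not> subseq (dbl u) (source ?\<beta>)" by (simp add: unsaturated_def)
    qed (use \<beta>(2) in \<open>auto simp: unsaturated_def\<close>)
    ultimately have "scan_inv t k (a # L) W H C ?\<beta> bs"
      by (intro scan_invI L H cnt distW bs) (simp_all add: C W \<beta>(3))
    with st dead show ?thesis by auto
  next
    case old
    let ?\<beta> = "\<beta>\<lparr>source := a # source \<beta>\<rparr>"
    have keep: "subseq v (kept \<beta>)"
      if "set v \<subseteq> alive \<beta>" "length v \<le> 2 * t + 2" "subseq v (a # source \<beta>)" for v
      using ext[OF that] old(2) that(2) W by auto
    have "good t ?\<beta>"
      unfolding good_def using keep sub length_le_of_subseq_Cons[OF \<beta>(2)]
      by (intro conjI allI impI) (simp_all add: list_emb_Cons)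
    moreover have "unsaturated t ?\<beta>"
      unfolding unsaturated_def
    proof (intro conjI allI impI notI)
      fix u assume u: "set u \<subseteq> alive ?\<beta>" "distinct u" "length u = t" "subseq (dbl u) (source ?\<beta>)"
      then have "subseq (dbl u) (kept \<beta>)" using keep[of "dbl u"] by simp
      then have "subseq (dbl u) (source \<beta>)" using sub by (rule subseq_order.trans)
      with u \<beta>(2) show False by (simp add: unsaturated_def)
    qed (use \<beta>(2) in \<open>auto simp: unsaturated_def\<close>)
    ultimately have "scan_inv t k (a # L) W H C ?\<beta> bs"
      by (intro scan_invI L H cnt distW bs) (simp_all add: C W \<beta>(3))
    with st old show ?thesis by auto
  next
    case new
    let ?\<beta> = "\<beta>\<lparr>source := a # source \<beta>, kept := a # kept \<beta>\<rparr>"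
    let ?W = "new_words (2 * t + 2) a W @ W"
    have setW: "set ?W = {v. subseq v (kept ?\<beta>) \<and> length v \<le> 2 * t + 2}"
    proof -
      have "set ?W = {a # v | v. subseq v (kept \<beta>) \<and> length v < 2 * t + 2} \<union>
          {v. subseq v (kept \<beta>) \<and> length v \<le> 2 * t + 2}"
        unfolding set_append set_new_words W by auto
      also have "\<dots> = {v. subseq v (a # kept \<beta>) \<and> length v \<le> 2 * t + 2}"
        unfolding subseq_Cons_right by auto
      finally show ?thesis by simp
    qed
    have "good t ?\<beta>"
      unfolding good_def using ext sub length_le_of_subseq_Cons[OF \<beta>(2)]
      by (intro conjI allI impI) (simp_all add: subseq_Cons_right)
    moreover have "unsaturated t ?\<beta>"
      unfolding unsaturated_def
    proof (intro conjI allI impI notI)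
      fix u assume u: "set u \<subseteq> alive ?\<beta>" "distinct u" "length u = t" "subseq (dbl u) (source ?\<beta>)"
      then have "subseq (dbl u) (kept ?\<beta>)" using ext[of "dbl u"] by (simp add: subseq_Cons_right)
      then have "dbl u \<in> set ?W" unfolding setW using u(3) by simp
      then have "dbl u \<in> set W" using new(3)[OF u(2,3)] by simp
      then have "subseq (dbl u) (source \<beta>)" using W sub subseq_order.trans by blast
      with u \<beta>(2) show False by (simp add: unsaturated_def)
    qed (use \<beta>(2,3) new(1) in \<open>auto simp: unsaturated_def\<close>)
    ultimately have "scan_inv t k (a # L) ?W H (a # C) ?\<beta> bs"
      by (intro scan_invI H cnt distinct_new_words distW setW bs) (use L in \<open>simp_all add: C \<beta>(3)\<close>)
    moreover have "W' = ?W" "H' = H" "C' = a # C" using st new(4) by auto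
    ultimately show ?thesis by blast
  next
    case (close T)
    let ?\<beta> = "\<beta>\<lparr>source := a # source \<beta>, kept := a # kept \<beta>, word := T\<rparr>"
    let ?\<gamma> = "\<lparr>source = [], kept = [], word = [], alive = {a. count_list (T @ H) a < 4 * k}\<rparr>"
    have T: "subseq (dbl T) (a # kept \<beta>)"
      using close(4) unfolding set_new_words W by (auto simp: subseq_Cons_right)
    have "set (a # kept \<beta>) \<subseteq> alive \<beta>" using close(1) \<beta>(2,3) by (auto simp: unsaturated_def)
    with subseq_set[OF T] have "set T \<subseteq> alive \<beta>" by auto
    moreover have "count_list T b \<le> 1" for b
      using close(2) by (simp add: count_list_distinct)
    ultimately have cnt': "count_list (T @ H) b \<le> 4 * k" for b
    proof (cases "b \<in> set T")
      case True
      with \<open>set T \<subseteq> alive \<beta>\<close> have "count_list H b < 4 * k" unfolding \<beta>(3) by blast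
      with \<open>count_list T b \<le> 1\<close> show ?thesis by simp
    next
      case False
      with cnt[of b] show ?thesis by simp
    qed
    have "good t ?\<beta>"
      unfolding good_def using ext sub length_le_of_subseq_Cons[OF \<beta>(2)]
      by (intro conjI allI impI) (simp_all add: subseq_Cons_right)
    moreover have "saturated t ?\<beta>" using T close by (simp add: saturated_def)
    moreover have "good t ?\<gamma>" "unsaturated t ?\<gamma>" using \<open>0 < t\<close>
      by (auto simp: good_def unsaturated_def dest: list_emb_Nil2)
    moreover have "- alive \<delta> \<subseteq> {a. 4 * k \<le> count_list (T @ H) a}" if "\<delta> \<in> set bs" for \<delta>
      using bs[OF that] by (auto intro: trans_le_add2)
    moreover have "- alive ?\<beta> \<subseteq> {a. 4 * k \<le> count_list (T @ H) a}" using \<beta>(3) by auto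
    ultimately have "scan_inv t k (a # L) [[]] (T @ H) (a # C) ?\<gamma> (?\<beta> # bs)"
      by (intro scan_invI cnt') (use L bs in \<open>auto simp: C H dest: list_emb_Nil2\<close>)
    moreover have "W' = [[]]" "H' = T @ H" "C' = a # C" using st close(5) by auto
    ultimately show ?thesis by blast
  qed
qed

lemma scan_inv: "0 < t \<Longrightarrow> scan t k L = (W, H, C) \<Longrightarrow> \<exists>\<beta> bs. scan_inv t k L W H C \<beta> bs"
proof (induction L arbitrary: W H C)
  case Nil
  then have "scan_inv t k [] W H C \<lparr>source = [], kept = [], word = [], alive = {a. 0 < k}\<rparr> []"
    by (auto simp: scan_def scan_inv_def good_def unsaturated_def dest: list_emb_Nil2)
  then show ?case by blast
next
  case (Cons a L)
  obtain W0 H0 C0 where "scan t k L = (W0, H0, C0)" by (cases "scan t k L")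
  with Cons scan_inv_step show ?case by (fastforce simp: scan_def)
qed

lemma subseq_kernel:
  assumes "0 < t"
  shows "subseq (kernel_word t k L) L"
proof -
  obtain W H C where s: "scan t k L = (W, H, C)" by (cases "scan t k L")
  from scan_inv[OF assms s] obtain \<beta> bs where inv: "scan_inv t k L W H C \<beta> bs" by blast
  have "subseq (concat (map kept xs)) (concat (map source xs))" if "\<forall>\<gamma>\<in>set xs. good t \<gamma>" for xs
    using that by (induction xs) (auto simp: good_def intro: list_emb_append_mono)
  from this[of "\<beta> # bs"] have "subseq C L" using inv unfolding scan_inv_def by auto
  then show ?thesis by (simp add: kernel_word_def s)
qed

lemma map_nth_upt: "map (\<lambda>j. f (xs ! j)) [0..<length xs] = map f xs"
  by (rule nth_equalityI) auto

lemma count_list_concat: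
  assumes "\<forall>\<beta>\<in>set bs. distinct (word \<beta>)"
  shows "count_list (concat (map word bs)) a = card {j. j < length bs \<and> a \<in> set (word (bs ! j))}"
  using assms
proof (induction bs)
  case (Cons \<beta> bs)
  have "{j. j < length (\<beta> # bs) \<and> a \<in> set (word ((\<beta> # bs) ! j))} =
    (if a \<in> set (word \<beta>) then {0} else {}) \<union> Suc ` {j. j < length bs \<and> a \<in> set (word (bs ! j))}"
    by (auto simp: image_iff less_Suc_eq_0_disj split: if_splits)
  then have "card {j. j < length (\<beta> # bs) \<and> a \<in> set (word ((\<beta> # bs) ! j))} =
    (if a \<in> set (word \<beta>) then 1 else 0) + card {j. j < length bs \<and> a \<in> set (word (bs ! j))}"
    by (auto simp: card_image card_insert_if)
  moreover have "count_list (word \<beta>) a = (if a \<in> set (word \<beta>) then 1 else 0)"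
    using Cons.prems by (simp add: count_list_distinct)
  ultimately show ?case using Cons by simp
qed simp

lemma optimum_kernel:
  assumes t: "t = 2 * q * q" "0 < q" and k: "card (set L) \<le> k"
  shows "q * optimum L \<le> q * optimum (kernel_word t k L) + 2 * optimum L"
proof -
  have "0 < t" using t by simp
  obtain W H C where s: "scan t k L = (W, H, C)" by (cases "scan t k L")
  from scan_inv[OF \<open>0 < t\<close> s] obtain \<beta> bs where inv: "scan_inv t k L W H C \<beta> bs" by blast
  define xs where "xs = \<beta> # bs"
  have inv': "L = concat (map source xs)" "kernel_word t k L = concat (map kept xs)"
    "\<And>a. count_list H a \<le> 4 * k" "\<And>\<gamma>. \<gamma> \<in> set xs \<Longrightarrow> good t \<gamma>"
    "\<And>\<gamma>. \<gamma> \<in> set xs \<Longrightarrow> word \<gamma> \<noteq> [] \<Longrightarrow> saturated t \<gamma>"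
    "\<And>\<gamma> a. \<gamma> \<in> set xs \<Longrightarrow> a \<notin> alive \<gamma> \<Longrightarrow> 4 * k \<le> count_list H a"
    using inv unfolding scan_inv_def unsaturated_def kernel_word_def s snd_conv xs_def by auto
  have dist: "\<forall>\<gamma>\<in>set xs. distinct (word \<gamma>)"
  proof
    fix \<gamma> assume "\<gamma> \<in> set xs"
    then show "distinct (word \<gamma>)"
      using inv'(5)[of \<gamma>] by (cases "word \<gamma> = []") (auto simp: saturated_def)
  qed
  have "H = concat (map word xs)"
    using inv by (simp add: scan_inv_def unsaturated_def xs_def)
  then have H: "count_list H a = card {j. j < length xs \<and> a \<in> set (word (xs ! j))}" for a
    using count_list_concat[OF dist] by simp
  obtain w where w: "distinct w" "subseq (dbl w) L" "length w = optimum L"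
    using optimum_witness by blast
  have "length w \<le> k"
    using subseq_set[OF w(2)] k card_mono[of "set L" "set w"] w(1) by (simp add: distinct_card)
  have "subseq (dbl (concat (map word ys))) (concat (map source ys))" if "set ys \<subseteq> set xs" for ys
    using that
  proof (induction ys)
    case (Cons \<gamma> ys)
    then have "subseq (dbl (word \<gamma>)) (source \<gamma>)"
      using inv'(4,5)[of \<gamma>] subseq_order.trans by (cases "word \<gamma>") (fastforce simp: saturated_def good_def)+
    with Cons show ?case by (auto intro: list_emb_append_mono)
  qed simp
  from this[of xs] have "card (set (concat (map word xs))) \<le> optimum L"
    using inv'(1) by (intro optimum_ge) auto
  also have "set (concat (map word xs)) = (\<Union>j<length xs. set (word (xs ! j)))"
  proof -
    have "set xs = (!) xs ` {..<length xs}" by (auto simp: set_conv_nth)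
    then show ?thesis by simp
  qed
  finally have U: "card (\<Union>j<length xs. set (word (xs ! j))) \<le> length w" using w(3) by simp
  have "\<exists>w'. subseq (dbl w') (concat (map (\<lambda>j. kept (xs ! j)) [0..<length xs])) \<and>
    q * length w \<le> q * card (set w') + 2 * length w"
  proof (rule exchange[where B = "\<lambda>j. source (xs ! j)" and T = "\<lambda>j. word (xs ! j)" and
      A = "\<lambda>j. alive (xs ! j)" and t = t and k = k])
    show "subseq (dbl w) (concat (map (\<lambda>j. source (xs ! j)) [0..<length xs]))"
      using w(2) inv'(1) unfolding map_nth_upt by simp
    show "subseq (dbl (word (xs ! j))) (kept (xs ! j)) \<and> distinct (word (xs ! j)) \<and> length (word (xs ! j)) = t"
      if "j < length xs" "word (xs ! j) \<noteq> []" for j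
      using inv'(5)[of "xs ! j"] that by (simp add: saturated_def)
    show "subseq v (kept (xs ! j))" if "j < length xs" "set v \<subseteq> alive (xs ! j)"
       "length v \<le> 2 * t + 2" "subseq v (source (xs ! j))" for j v
      using inv'(4)[of "xs ! j"] that by (simp add: good_def)
    show "length u \<le> t" if "j < length xs" "set u \<subseteq> alive (xs ! j)"
       "distinct u" "subseq (dbl u) (source (xs ! j))" for j u
      using inv'(4)[of "xs ! j"] that by (simp add: good_def)
    show "4 * k \<le> card {j. j < length xs \<and> a \<in> set (word (xs ! j))}"
      if "j < length xs" "a \<notin> alive (xs ! j)" for j a
      using inv'(6)[of "xs ! j" a] that H by simp
  qed (use w(1) U \<open>length w \<le> k\<close> t inv'(3) H in auto)
  then obtain w' where "subseq (dbl w') (kernel_word t k L)" "q * length w \<le> q * card (set w') + 2 * length w"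
    unfolding map_nth_upt inv'(2) by blast
  moreover from this(1) have "q * card (set w') \<le> q * optimum (kernel_word t k L)"
    by (intro mult_le_mono2 optimum_ge)
  ultimately show ?thesis unfolding w(3) by linarith
qed

lemma length_le_words: "finite A \<Longrightarrow> distinct W \<Longrightarrow> \<forall>v\<in>set W. set v \<subseteq> A \<and> length v \<le> r \<Longrightarrow>
    length W \<le> Suc r * Suc (card A) ^ r"
proof -
  assume *: "finite A" "distinct W" "\<forall>v\<in>set W. set v \<subseteq> A \<and> length v \<le> r"
  have "length W = card (set W)" using * by (simp add: distinct_card)
  also have "\<dots> \<le> card {v. set v \<subseteq> A \<and> length v \<le> r}"
    using * by (intro card_mono finite_lists_length_le) auto
  also have "\<dots> = (\<Sum>i\<le>r. card A ^ i)" using * by (simp add: card_lists_length_le)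
  also have "\<dots> \<le> (\<Sum>i\<le>r. Suc (card A) ^ r)"
    by (intro sum_mono order.trans[OF power_mono power_increasing]) auto
  finally show ?thesis by simp
qed

lemma scan_bounds:
  assumes "scan t k L = (W, H, C)"
  shows "distinct W \<and> (\<forall>v\<in>set W. set v \<subseteq> set L \<and> length v \<le> 2 * t + 2) \<and>
    set H \<subseteq> set L \<and> length H \<le> t * length L \<and> set C \<subseteq> set L \<and> length C \<le> length L"
  using assms
proof (induction L arbitrary: W H C)
  case (Cons a L)
  obtain W0 H0 C0 where s: "scan t k L = (W0, H0, C0)" by (cases "scan t k L")
  note IH = Cons.IH[OF s]
  have st: "step t k a (W0, H0, C0) = (W, H, C)" using Cons.prems s by (simp add: scan_def)
  show ?case
  proof (cases rule: scan_step[of k H0 a t W0 C0])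
    case new
    have eqs: "W = new_words (2 * t + 2) a W0 @ W0" "H = H0" "C = a # C0"
      using new(4) st by auto
    have W: "set v \<subseteq> set (a # L) \<and> length v \<le> 2 * t + 2" if v: "v \<in> set W" for v
    proof -
      from v[unfolded eqs] consider "v \<in> set W0" | v' where "v = a # v'" "v' \<in> set W0" "length v' < 2 * t + 2"
        by (auto simp: set_new_words)
      then show ?thesis
      proof cases
        case 2
        with IH have "set v' \<subseteq> set L" by blast
        with 2 show ?thesis by auto
      qed (use IH in auto)
    qed
    have "distinct W" unfolding eqs using IH by (intro distinct_new_words) simp
    moreover have "set H \<subseteq> set (a # L)" "length H \<le> t * length (a # L)" "set C \<subseteq> set (a # L)"
      "length C \<le> length (a # L)" unfolding eqs using IH by auto
    ultimately show ?thesis by (intro conjI ballI W)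
  next
    case (close T)
    from close(4) obtain v where v: "dbl T = a # v" "v \<in> set W0" unfolding set_new_words by blast
    have "set T \<subseteq> insert a (set L)"
      unfolding set_dbl[of T, symmetric] v(1) using IH v(2) by auto
    moreover have "W = [[]]" "H = T @ H0" "C = a # C0" using close(5) st by auto
    ultimately show ?thesis using IH close(3) by auto
  qed (use IH st in auto)
qed (auto simp: scan_def)

text \<open>Every kept letter enlarges \<open>W\<close>, and \<open>W\<close> is reset only when \<open>H\<close> grows.\<close>

lemma length_kernel_aux:
  assumes "scan t k L = (W, H, C)" "0 < t" "\<And>U. distinct U \<Longrightarrow>
     (\<forall>v\<in>set U. set v \<subseteq> set L \<and> length v \<le> 2 * t + 2) \<Longrightarrow> length U \<le> M"
  shows "Suc (length C) \<le> M * length H + length W"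
  using assms(1,3)
proof (induction L arbitrary: W H C)
  case (Cons a L)
  obtain W0 H0 C0 where s: "scan t k L = (W0, H0, C0)" by (cases "scan t k L")
  have IH: "Suc (length C0) \<le> M * length H0 + length W0"
    by (rule Cons.IH[OF s]) (rule Cons.prems(2), auto)
  have st: "step t k a (W0, H0, C0) = (W, H, C)" using Cons.prems s by (simp add: scan_def)
  show ?case
  proof (cases rule: scan_step[of k H0 a t W0 C0])
    case new
    have eqs: "length W = length (new_words (2 * t + 2) a W0) + length W0" "H = H0" "length C = Suc (length C0)"
      using new(4) st by auto
    moreover have "1 \<le> length (new_words (2 * t + 2) a W0)" using new(2) by (simp add: Suc_le_eq)
    ultimately show ?thesis unfolding eqs(2) using IH by linarith
  next
    case (close T)
    have "length W0 \<le> M" using scan_bounds[OF s] by (intro Cons.prems(2)) auto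
    also have "M \<le> M * length T" using close(3) assms(2) by simp
    finally show ?thesis using IH st close by (auto simp: algebra_simps)
  qed (use IH st in auto)
qed (auto simp: scan_def)

lemma length_kernel:
  assumes "0 < t" "card (set L) \<le> k"
  shows "length (kernel_word t k L) \<le> Suc (2 * t + 2) * Suc k ^ (2 * t + 2) * (4 * k * k + 1)"
proof -
  obtain W H C where s: "scan t k L = (W, H, C)" by (cases "scan t k L")
  from scan_inv[OF assms(1) s] obtain \<beta> bs where "scan_inv t k L W H C \<beta> bs" by blast
  then have H: "count_list H a \<le> 4 * k" for a unfolding scan_inv_def by blast
  define M where "M = Suc (2 * t + 2) * Suc k ^ (2 * t + 2)"
  have M: "length U \<le> M" if "distinct U" "\<forall>v\<in>set U. set v \<subseteq> set L \<and> length v \<le> 2 * t + 2" for U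
  proof -
    have "length U \<le> Suc (2 * t + 2) * Suc (card (set L)) ^ (2 * t + 2)"
      by (rule length_le_words[OF _ that]) simp
    also have "\<dots> \<le> M"
      unfolding M_def by (rule mult_le_mono2, rule power_mono) (use assms(2) in simp_all)
    finally show ?thesis .
  qed
  have "length H = (\<Sum>a\<in>set L. count_list H a)"
    using scan_bounds[OF s] sum_count_set[of H "set L"] by simp
  also have "\<dots> \<le> (\<Sum>a\<in>set L. 4 * k)" by (intro sum_mono H)
  also have "\<dots> = card (set L) * (4 * k)" by simp
  also have "\<dots> \<le> k * (4 * k)" using assms(2) by (rule mult_le_mono1)
  also have "\<dots> = 4 * k * k" by simp
  finally have "M * length H \<le> M * (4 * k * k)" by (rule mult_le_mono2)
  moreover have "length W \<le> M" using scan_bounds[OF s] by (intro M) auto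
  moreover have "Suc (length C) \<le> M * length H + length W"
    by (rule length_kernel_aux[OF s assms(1) M])
  moreover have "M * (4 * k * k + 1) = M * (4 * k * k) + M" by simp
  ultimately have "length C \<le> M * (4 * k * k + 1)" by linarith
  then show ?thesis by (simp only: kernel_word_def s snd_conv M_def)
qed

section \<open>Running time\<close>

lemma ptime_nat_mem:
  assumes "ptime e (enc_list enc_nat) xs" "ptime e enc_nat f"
  shows "ptime e enc_bool (\<lambda>x. f x \<in> set (xs x))"
proof -
  have "ptime e enc_bool (\<lambda>x. \<exists>y\<in>set (xs x). f x = y)"
    by (intro ptime_bex[OF assms(1)] ptime_nat_eq ptime_comp[OF assms(2)] ptime_fst ptime_snd)
      (rule ptime_id)+
  then show ?thesis by simp
qed

lemma ptime_word_mem: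
  assumes "ptime e (enc_list (enc_list enc_nat)) xs" "ptime e (enc_list enc_nat) f"
  shows "ptime e enc_bool (\<lambda>x. f x \<in> set (xs x))"
proof -
  have "ptime e enc_bool (\<lambda>x. \<exists>y\<in>set (xs x). f x = y)"
    by (intro ptime_bex[OF assms(1)] ptime_word_eq ptime_comp[OF assms(2)] ptime_fst ptime_snd)
      (rule ptime_id)+
  then show ?thesis by simp
qed

lemma ptime_dbl:
  assumes "ptime e (enc_list a) w"
  shows "ptime e (enc_list a) (\<lambda>x. dbl (w x))"
  unfolding dbl_def
proof (rule ptime_list_of_foldr[OF assms ptime_const _ ptime_pbd[OF assms] _
      pbd_mult[OF pbd_const[of _ 2] pbd_length[OF assms]]])
  show "tsize (a v) \<le> tsize (enc_list a (w x))"
    if "v \<in> set (foldr (\<lambda>a v. a # a # v) (drop n (w x)) [])" for x n v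
    using that unfolding dbl_def[symmetric] set_dbl by (intro enc_list_elem_le) (rule in_set_dropD)
  show "length (foldr (\<lambda>a v. a # a # v) (drop n (w x)) []) \<le> 2 * length (w x)" for x n
    unfolding dbl_def[symmetric] length_dbl by simp
qed (rule ptime_basic)+

lemma ptime_remdups:
  assumes "ptime e (enc_list enc_nat) w"
  shows "ptime e (enc_list enc_nat) (\<lambda>x. remdups (w x))"
proof -
  have foldr: "foldr (\<lambda>y zs. if y \<in> set zs then zs else y # zs) xs [] = remdups xs" for xs :: "nat list"
    by (induction xs) auto
  have "ptime e (enc_list enc_nat) (\<lambda>x. foldr (\<lambda>y zs. if y \<in> set zs then zs else y # zs) (w x) [])"
  proof (rule ptime_list_of_foldr[OF assms ptime_const _ ptime_pbd[OF assms] _ pbd_length[OF assms]])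
    show "tsize (enc_nat v) \<le> tsize (enc_list enc_nat (w x))"
      if "v \<in> set (foldr (\<lambda>y zs. if y \<in> set zs then zs else y # zs) (drop n (w x)) [])" for x n v
      using that unfolding foldr set_remdups by (intro enc_list_elem_le) (rule in_set_dropD)
    show "length (foldr (\<lambda>y zs. if y \<in> set zs then zs else y # zs) (drop n (w x)) []) \<le> length (w x)" for x n
      unfolding foldr using length_remdups_leq[of "drop n (w x)"] by simp
  qed (rule ptime_if ptime_nat_mem ptime_basic)+
  then show ?thesis by (simp add: foldr)
qed

lemma ptime_is_dbl:
  assumes "ptime e (enc_list enc_nat) w"
  shows "ptime e enc_bool (\<lambda>x. is_dbl t (w x))"
  unfolding is_dbl_def
  by (intro ptime_conj ptime_nat_eq ptime_word_eq ptime_length[OF assms] ptime_dbl ptime_remdups assms ptime_const)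

abbreviation "enc_word \<equiv> enc_list enc_nat"

lemma ptime_new_words:
  assumes "ptime e enc_nat a" "ptime e (enc_list enc_word) W"
  shows "ptime e (enc_list enc_word) (\<lambda>x. new_words r (a x) (W x))"
  unfolding new_words_def
proof (intro ptime_filter ptime_map ptime_not ptime_word_mem)
  show "ptime e (enc_list enc_word) W" by fact
  show "ptime (enc_pair e enc_word) enc_bool (\<lambda>p. length (snd p) < r)"
    by (intro ptime_nat_less ptime_length[where a = enc_nat] ptime_snd ptime_const) (rule ptime_id)
  show "ptime (enc_pair e enc_word) enc_word (\<lambda>p. a (fst p) # snd p)"
    by (intro ptime_Cons ptime_comp[OF assms(1)] ptime_fst ptime_snd) (rule ptime_id)+
  show "ptime (enc_pair e enc_word) (enc_list enc_word) (\<lambda>p. W (fst p))"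
    by (intro ptime_comp[OF assms(2)] ptime_fst) (rule ptime_id)
  show "ptime (enc_pair e enc_word) enc_word snd"
    by (intro ptime_snd[of _ e enc_word "\<lambda>x. x"]) (rule ptime_id)
qed

abbreviation "enc_state \<equiv> enc_pair (enc_list enc_word) (enc_pair enc_word enc_word)"

lemma step_eq:
  "step t k a s =
    (if k + k + k + k \<le> count_list (fst (snd s)) a then s
     else if new_words (2 * t + 2) a (fst s) = [] then s
     else case filter (is_dbl t) (new_words (2 * t + 2) a (fst s)) of
       [] \<Rightarrow> (new_words (2 * t + 2) a (fst s) @ fst s, fst (snd s), a # snd (snd s))
     | v # _ \<Rightarrow> ([[]], remdups v @ fst (snd s), a # snd (snd s)))"
  by (cases s) (auto simp: step_def split: list.split)

lemma ptime_step:
  "ptime (enc_pair enc_nat (enc_pair enc_nat enc_state)) enc_state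
     (\<lambda>p. step t (fst p) (fst (snd p)) (snd (snd p)))"
proof -
  let ?E = "enc_pair enc_nat (enc_pair enc_nat enc_state)"
  have k: "ptime ?E enc_nat fst" using ptime_fst[OF ptime_id] .
  have a: "ptime ?E enc_nat (\<lambda>p. fst (snd p))" by (rule ptime_basic)+
  have s: "ptime ?E enc_state (\<lambda>p. snd (snd p))" by (rule ptime_basic)+
  note W = ptime_fst[OF s] and H = ptime_fst[OF ptime_snd[OF s]] and C = ptime_snd[OF ptime_snd[OF s]]
  note new = ptime_new_words[OF a W, of "2 * t + 2"]
  have dbl: "ptime ?E (enc_list enc_word)
      (\<lambda>p. filter (is_dbl t) (new_words (2 * t + 2) (fst (snd p)) (fst (snd (snd p)))))"
    by (intro ptime_filter[OF new] ptime_is_dbl ptime_snd) (rule ptime_id)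
  note fst = ptime_fst[OF ptime_id]
  have close: "ptime (enc_pair ?E (enc_pair enc_word (enc_list enc_word))) enc_state
      (\<lambda>p. ([[]], remdups (fst (snd p)) @ fst (snd (snd (snd (fst p)))),
        fst (snd (fst p)) # snd (snd (snd (snd (fst p))))))"
    by (intro ptime_pair ptime_const ptime_append ptime_remdups ptime_Cons
        ptime_comp[OF a fst] ptime_comp[OF H fst] ptime_comp[OF C fst] ptime_fst ptime_snd)
      (rule ptime_id)
  show ?thesis
    unfolding step_eq
    by (rule ptime_if[OF ptime_nat_le[OF _ ptime_count_list[OF H a]] s
          ptime_if[OF ptime_Nil_eq[OF new] s ptime_case_list[OF dbl _ close]]]
        ptime_pair ptime_append[OF new W] H ptime_Cons[OF a C] ptime_add k)+
qed

lemma tsize_scan_le: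
  assumes "scan t k L = s"
  defines "S \<equiv> tsize (enc_word L)"
  shows "tsize (enc_state s) \<le> 2 + Suc (Suc (2 * t + 2) * Suc S ^ (2 * t + 2) * Suc (Suc ((2 * t + 2) * Suc S)))
     + (Suc (t * S * Suc S) + Suc (S * Suc S))"
proof -
  obtain W H C where s: "s = (W, H, C)" by (cases s)
  note b = scan_bounds[OF assms(1)[unfolded s]]
  have len: "length L \<le> S" unfolding S_def by (rule length_le_tsize)
  have elem: "tsize (enc_nat a) \<le> S" if "a \<in> set L" for a
    unfolding S_def using enc_list_elem_le[OF that] .
  have "length W \<le> Suc (2 * t + 2) * Suc (card (set L)) ^ (2 * t + 2)"
    using b by (intro length_le_words) auto
  also have "\<dots> \<le> Suc (2 * t + 2) * Suc S ^ (2 * t + 2)"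
    using card_length[of L] len by (intro mult_le_mono2 power_mono) auto
  finally have "tsize (enc_list enc_word W) \<le>
      Suc (Suc (2 * t + 2) * Suc S ^ (2 * t + 2) * Suc (Suc ((2 * t + 2) * Suc S)))"
  proof (rule enc_list_size_le[rotated])
    fix v assume "v \<in> set W"
    with b have v: "set v \<subseteq> set L" "length v \<le> 2 * t + 2" by blast+
    then show "tsize (enc_word v) \<le> Suc ((2 * t + 2) * Suc S)"
      using elem by (intro enc_list_size_le) auto
  qed
  moreover have "tsize (enc_word H) \<le> Suc (t * S * Suc S)"
  proof (rule enc_list_size_le)
    show "length H \<le> t * S" using b len by (meson le_trans mult_le_mono2)
  qed (use b elem in blast)
  moreover have "tsize (enc_word C) \<le> Suc (S * Suc S)"
    using b len elem by (intro enc_list_size_le) (blast, linarith)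
  ultimately show ?thesis unfolding s enc_pair.simps tsize.simps by linarith
qed

lemma ptime_kernel:
  "ptime (enc_pair enc_word enc_nat) (enc_pair enc_word enc_nat) (\<lambda>x. (kernel_word t (snd x) (fst x), snd x))"
proof -
  let ?E = "enc_pair enc_word enc_nat"
  have L: "ptime ?E enc_word fst" and k: "ptime ?E enc_nat snd"
    using ptime_fst[OF ptime_id] ptime_snd[OF ptime_id] by blast+
  let ?S = "\<lambda>x. tsize (enc_word (fst x))"
  let ?B = "\<lambda>S. 2 + Suc (Suc (2 * t + 2) * Suc S ^ (2 * t + 2) * Suc (Suc ((2 * t + 2) * Suc S)))
     + (Suc (t * S * Suc S) + Suc (S * Suc S))"
  have "ptime ?E enc_state (\<lambda>x. foldr (step t (snd x)) (fst x) ([[]], [], []))"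
  proof (rule ptime_foldr[OF L ptime_const, where B = "\<lambda>x. ?B (?S x)"])
    show "ptime (enc_pair ?E (enc_pair enc_nat enc_state)) enc_state
        (\<lambda>p. step t (snd (fst p)) (fst (snd p)) (snd (snd p)))"
    proof -
      have "ptime (enc_pair ?E (enc_pair enc_nat enc_state)) (enc_pair enc_nat (enc_pair enc_nat enc_state))
          (\<lambda>p. (snd (fst p), snd p))"
        by (rule ptime_basic)+
      from ptime_comp[OF ptime_step this] show ?thesis by simp
    qed
    show "pbd ?E (\<lambda>x. ?B (?S x))" by (intro pbd_intros ptime_pbd[OF L])
    fix x :: "nat list \<times> nat" and n
    let ?D = "drop n (fst x)"
    have "tsize (enc_state (scan t (snd x) ?D)) \<le> ?B (tsize (enc_word ?D))"
      by (rule tsize_scan_le) simp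
    also have "\<dots> \<le> ?B (?S x)"
      using enc_list_drop_le[of enc_nat n "fst x"] by (intro add_mono mult_mono Suc_le_mono[THEN iffD2] power_mono) auto
    finally show "tsize (enc_state (foldr (step t (snd x)) ?D ([[]], [], []))) \<le> ?B (?S x)"
      by (simp only: scan_def)
  qed
  then show ?thesis
    unfolding kernel_word_def scan_def by (intro ptime_pair ptime_snd[OF ptime_snd] k) 
qed

lemma positions_bounds:
  "length (positions i xs ys) \<le> length ys \<and> (\<forall>p\<in>set (positions i xs ys). p < i + length ys)"
  by (induction i xs ys rule: positions.induct) auto

definition position_step :: "nat \<Rightarrow> nat \<times> nat list \<times> nat list \<Rightarrow> nat \<times> nat list \<times> nat list" where
  "position_step y s = (Suc (fst s), (case fst (snd s) of [] \<Rightarrow> snd s | x # xs \<Rightarrow>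
     if y = x then (xs, fst s # snd (snd s)) else snd s))"

lemma fold_position_step:
  "fold position_step ys (i, xs, ps) =
    (i + length ys, drop (length (positions i xs ys)) xs, rev (positions i xs ys) @ ps)"
proof (induction i xs ys arbitrary: ps rule: positions.induct)
  case (2 i y ys)
  have "positions (Suc i) [] ys = ([] :: nat list)" by (cases ys) auto
  moreover have step: "position_step z (j, [], ps) = (Suc j, [], ps)" for z j
    by (simp add: position_step_def)
  moreover have "fold position_step zs (j, [], ps) = (j + length zs, [], ps)" for zs j
    by (induction zs arbitrary: j) (auto simp: step)
  ultimately show ?case by simp
qed (auto simp: position_step_def)

lemma ptime_positions:
  assumes f: "ptime e enc_word f" and g: "ptime e enc_word g"
  shows "ptime e enc_word (\<lambda>x. positions 0 (f x) (g x))"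
proof -
  let ?enc = "enc_pair enc_nat (enc_pair enc_word enc_word)"
  let ?S = "\<lambda>x. tsize (enc_word (g x))"
  let ?B = "\<lambda>x. 2 + (2 * ?S x + 1) + (tsize (enc_word (f x)) + Suc (?S x * Suc (2 * ?S x + 1)))"
  have "ptime e ?enc (\<lambda>x. fold position_step (g x) (0, f x, []))"
  proof (rule ptime_fold[OF g, where B = ?B])
    show "ptime e ?enc (\<lambda>x. (0, f x, []))" by (intro ptime_pair ptime_const f)
    show "pbd e ?B" by (intro pbd_intros ptime_pbd[OF f] ptime_pbd[OF g])
    let ?E = "enc_pair e (enc_pair enc_nat ?enc)"
    have s: "ptime ?E ?enc (\<lambda>p. snd (snd p))" by (rule ptime_basic)+
    have y: "ptime ?E enc_nat (\<lambda>p. fst (snd p))" by (rule ptime_basic)+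
    note fst = ptime_fst[OF ptime_id]
    have "ptime (enc_pair ?E (enc_pair enc_nat enc_word)) (enc_pair enc_word enc_word)
      (\<lambda>p. if fst (snd (fst p)) = fst (snd p) then
         (snd (snd p), fst (snd (snd (fst p))) # snd (snd (snd (snd (fst p))))) else snd (snd (snd (fst p))))"
      by (intro ptime_if ptime_nat_eq ptime_pair ptime_Cons ptime_comp[OF y fst]
          ptime_comp[OF ptime_fst[OF s] fst] ptime_comp[OF ptime_snd[OF ptime_snd[OF s]] fst]
          ptime_comp[OF ptime_snd[OF s] fst] ptime_fst ptime_snd) (rule ptime_id)+
    then show "ptime ?E ?enc (\<lambda>p. position_step (fst (snd p)) (snd (snd p)))"
      unfolding position_step_def
      by (intro ptime_pair ptime_Suc ptime_fst[OF s] ptime_case_list[OF ptime_fst[OF ptime_snd[OF s]]]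
          ptime_snd[OF s])
    fix x n
    let ?ys = "take n (g x)"
    have len: "length ?ys \<le> ?S x" using length_le_tsize[where a = enc_nat and ys = "g x"] by simp
    have "tsize (enc_word (rev (positions 0 (f x) ?ys))) \<le> Suc (?S x * Suc (2 * ?S x + 1))"
    proof (rule enc_list_size_le)
      fix p assume "p \<in> set (rev (positions 0 (f x) ?ys))"
      with positions_bounds[of 0 "f x" ?ys] have "p < length ?ys" by simp
      with len have "p \<le> ?S x" by linarith
      then show "tsize (enc_nat p) \<le> 2 * ?S x + 1" unfolding enc_nat_size by simp
    next
      have "length (positions 0 (f x) ?ys) \<le> length ?ys" using positions_bounds by blast
      with len show "length (rev (positions 0 (f x) ?ys)) \<le> ?S x" unfolding length_rev by linarith
    qed
    moreover have "tsize (enc_nat (0 + length ?ys)) \<le> 2 * ?S x + 1"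
      unfolding enc_nat_size using len by simp
    moreover have "tsize (enc_word (drop (length (positions 0 (f x) ?ys)) (f x))) \<le> tsize (enc_word (f x))"
      by (rule enc_list_drop_le)
    ultimately show "tsize (?enc (fold position_step ?ys (0, f x, []))) \<le> ?B x"
      unfolding fold_position_step enc_pair.simps tsize.simps append_Nil2 by linarith
  qed
  from ptime_rev[OF ptime_snd[OF ptime_snd[OF this]]] show ?thesis
    by (simp add: fold_position_step)
qed

lemma ptime_nth0:
  assumes "ptime e enc_word f" "ptime e enc_nat g"
  shows "ptime e enc_nat (\<lambda>x. nth0 (f x) (g x))"
  unfolding nth0_def
  by (intro ptime_case_list[OF ptime_drop[OF assms]] ptime_const ptime_fst ptime_snd) (rule ptime_id)

lemma ptime_lift_solution:
  "ptime (enc_pair (enc_pair enc_word enc_nat) (enc_pair (enc_pair enc_word enc_nat)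
     (enc_list (enc_pair enc_nat enc_nat)))) (enc_list (enc_pair enc_nat enc_nat)) lift_solution"
proof -
  let ?pair = "enc_pair enc_nat enc_nat"
  let ?E = "enc_pair (enc_pair enc_word enc_nat) (enc_pair (enc_pair enc_word enc_nat) (enc_list ?pair))"
  have s: "ptime ?E (enc_list ?pair) (\<lambda>z. snd (snd z))" by (rule ptime_basic)+
  have L: "ptime ?E enc_word (\<lambda>z. fst (fst z))" by (rule ptime_basic)+
  have L': "ptime ?E enc_word (\<lambda>z. fst (fst (snd z)))" by (rule ptime_basic)+
  note P = ptime_comp[OF ptime_positions[OF L' L] ptime_fst[OF ptime_id]]
  have "ptime ?E (enc_list ?pair) (\<lambda>z. map (\<lambda>f. (nth0 (positions 0 (fst (fst (snd z))) (fst (fst z))) (fst f),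
      nth0 (positions 0 (fst (fst (snd z))) (fst (fst z))) (snd f))) (snd (snd z)))"
    by (intro ptime_map[OF s] ptime_pair ptime_nth0 P ptime_fst ptime_snd) (rule ptime_id)+
  then show ?thesis by (simp add: lift_solution_def[abs_def] Let_def)
qed

theorem theorem5p8:
  shows "admits_PSAKS Disjoint_Factors"
  unfolding admits_PSAKS_def
proof (intro allI impI)
  fix \<alpha> :: real assume \<alpha>: "1 < \<alpha>"
  define q where "q = nat \<lceil>2 * \<alpha> / (\<alpha> - 1)\<rceil> + 3"
  define t where "t = 2 * q * q"
  have q: "0 < q" "3 \<le> q" by (auto simp: q_def)
  have t: "0 < t" using q by (simp add: t_def)
  have "2 * \<alpha> / (\<alpha> - 1) \<le> real q" unfolding q_def by linarith
  then have q\<alpha>: "real q \<le> \<alpha> * (real q - 2)" using \<alpha> by (simp add: field_simps)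
  define reduce where "reduce x = (kernel_word t (snd x) (fst x), snd x)" for x :: "nat list \<times> nat"
  let ?DF = Disjoint_Factors
  have enc: "enc_inst ?DF = enc_word" "enc_sol ?DF = enc_list (enc_pair enc_nat enc_nat)"
    "insts ?DF = {(L, k). set L \<subseteq> {..<k}}"
    by (auto simp: Disjoint_Factors_def)
  have card_le: "card (set L) \<le> k" if "set L \<subseteq> {..<k}" for L :: "nat list" and k
    using card_mono[OF _ that] by simp
  have "approx_preprocessing ?DF \<alpha> reduce lift_solution"
    unfolding approx_preprocessing_def
  proof (intro conjI allI impI)
    show "poly_time_on (insts ?DF) (enc_pinst ?DF) (enc_pinst ?DF) reduce"
      using ptime_kernel[of t] unfolding enc reduce_def poly_time_on_def by blast
    show "poly_time_on {(X, reduce X, s') |X s'. X \<in> insts ?DF}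
       (enc_pair (enc_pinst ?DF) (enc_pair (enc_pinst ?DF) (enc_sol ?DF))) (enc_sol ?DF) lift_solution"
      using ptime_lift_solution unfolding enc poly_time_on_def by blast
  next
    fix L L' :: "nat list" and k k' :: nat
    assume inst: "(L, k) \<in> insts ?DF" and "reduce (L, k) = (L', k')"
    then have L': "L' = kernel_word t k L" "k' = k" by (auto simp: reduce_def)
    have sub: "subseq L' L" unfolding L' by (rule subseq_kernel[OF t])
    have k: "set L \<subseteq> {..<k}" using inst by (simp add: enc)
    then show "(L', k') \<in> insts ?DF" using subseq_set[OF sub] by (auto simp: enc L'(2))
    have "q * optimum L \<le> q * optimum L' + 2 * optimum L"
      unfolding L' using optimum_kernel[OF t_def q(1) card_le[OF k]] .
    then have "real (q * optimum L) \<le> real (q * optimum L' + 2 * optimum L)"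
      by (simp only: of_nat_le_iff)
    then have "(real q - 2) * real (optimum L) \<le> real q * real (optimum L')"
      by (simp add: algebra_simps)
    also have "\<dots> \<le> \<alpha> * (real q - 2) * real (optimum L')"
      using q\<alpha> by (intro mult_right_mono) auto
    finally have "(real q - 2) * real (optimum L) \<le> (real q - 2) * (\<alpha> * real (optimum L'))"
      by (simp add: algebra_simps)
    then have "real (optimum L) \<le> \<alpha> * real (optimum L')"
      using q(2) by simp
    from ratio_lift[OF sub this \<alpha>]
    show "ratio ?DF L' k' s' \<le> ereal \<alpha> * ratio ?DF L k (lift_solution ((L, k), (L', k'), s'))" for s' .
  qed
  moreover have "\<exists>g :: nat poly. \<forall>L k L' k'. (L, k) \<in> insts ?DF \<longrightarrow> reduce (L, k) = (L', k') \<longrightarrow>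
      inst_size ?DF L' + k' \<le> poly g k"
  proof -
    let ?N = "\<lambda>k. Suc (2 * t + 2) * Suc k ^ (2 * t + 2) * (4 * k * k + 1)"
    let ?h = "\<lambda>k. Suc (?N k * Suc (2 * k + 1)) + k"
    have "pbd enc_nat (\<lambda>k. k)"
      by (rule pbd_mono[OF pbd_size]) (simp add: enc_nat_size)
    then have "pbd enc_nat ?h" by (intro pbd_intros)
    then obtain c where c: "\<And>k. ?h k \<le> poly c (2 * k + 1)"
      unfolding pbd_def enc_nat_size by blast
    have "inst_size ?DF L' + k' \<le> poly (pcompose c [:1, 2:]) k"
      if "(L, k) \<in> insts ?DF" "reduce (L, k) = (L', k')" for L k L' k'
    proof -
      have L': "L' = kernel_word t k L" "k' = k" using that(2) by (auto simp: reduce_def)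
      have k: "set L \<subseteq> {..<k}" using that(1) by (simp add: enc)
      have "tsize (enc_word L') \<le> Suc (?N k * Suc (2 * k + 1))"
      proof (rule enc_list_size_le)
        fix a assume "a \<in> set L'"
        then have "a < k" using subseq_set[OF subseq_kernel[OF t, of k L]] k unfolding L' by auto
        then show "tsize (enc_nat a) \<le> 2 * k + 1" unfolding enc_nat_size by simp
      next
        show "length L' \<le> ?N k" unfolding L' by (rule length_kernel[OF t card_le[OF k]])
      qed
      then have "inst_size ?DF L' + k' \<le> ?h k" by (simp add: inst_size_def enc L'(2))
      also have "\<dots> \<le> poly (pcompose c [:1, 2:]) k" using c[of k] by (simp add: poly_pcompose mult.commute)
      finally show ?thesis .
    qed
    then show ?thesis by blast
  qed
  ultimately show "has_poly_approx_kernel ?DF \<alpha>"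
    unfolding has_poly_approx_kernel_def by blast
qed

end
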